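(* Let $W=(x_1,\dots,x_n,f(x_1,\dots,x_n))$ be a local $(n+1)$-web of codimension 1 near the origin of $\mathbb R^n$. If $W$ admits an infinitesimal isomorphism which vanishes at the origin but is not identically zero, then $W$ is parallelizable.
   Context: Everything is local near the origin of $\mathbb R^n$, and all functions and vector fields are real analytic. A $d$-web of codimension 1 is a family of $d$ foliations of codimension 1, any $n$ of which are transverse; it is denoted by its first integrals $(f_1,\dots,f_d)$. Here $W=(x_1,\dots,x_n,f)$ with all partial derivatives $\partial f/\partial x_i$ non-vanishing. The web is parallelizable if there are local coordinates in which all its foliations admit linear first integrals. An infinitesimal isomorphism of $W$ is a vector field whose flow preserves each of the $n+1$ foliations, i.e. a vector field $X=\sum_iX_i(x_i)\,\partial/\partial x_i$ with $X\cdot f=\phi\circ f$ for some function $\phi$ of one variable. *)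

theory Defs
  imports "HOL-Analysis.Analysis"
begin

text \<open>
  Real analyticity in several variables.  Multi-indices are the functions from the standard
  basis to the naturals, and the power series is required to converge unconditionally
  on a ball around the point.
\<close>

definition real_analytic_at :: "('a::euclidean_space \<Rightarrow> 'b::real_normed_vector) \<Rightarrow> 'a \<Rightarrow> bool" where
  "real_analytic_at f a \<longleftrightarrow>
     (\<exists>c r. r > 0 \<and>
        (\<forall>x\<in>ball a r.
           ((\<lambda>\<alpha>. (\<Prod>b\<in>Basis. ((x - a) \<bullet> b) ^ \<alpha> b) *\<^sub>R c \<alpha>) has_sum f x)
             (Basis \<rightarrow>\<^sub>E (UNIV :: nat set))))"

definition real_analytic_on :: "'a::euclidean_space set \<Rightarrow> ('a \<Rightarrow> 'b::real_normed_vector) \<Rightarrow> bool" where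
  "real_analytic_on U f \<longleftrightarrow> (\<forall>a\<in>U. real_analytic_at f a)"

definition gradient :: "(real^'n \<Rightarrow> real) \<Rightarrow> real^'n \<Rightarrow> real^'n" where
  "gradient f x = (\<chi> i. frechet_derivative f (at x) (axis i 1))"

definition submersion_on :: "(real^'n) set \<Rightarrow> (real^'n \<Rightarrow> real) \<Rightarrow> bool" where
  "submersion_on U f \<longleftrightarrow> real_analytic_on U f \<and> (\<forall>x\<in>U. gradient f x \<noteq> 0)"

text \<open>
  A codimension 1 foliation of an open set is represented by its set of leaves.  The one with
  first integral \<open>f\<close> has as leaves the connected components of the level sets of \<open>f\<close>.
\<close>

definition foliation_of :: "(real^'n) set \<Rightarrow> (real^'n \<Rightarrow> real) \<Rightarrow> (real^'n) set set" where
  "foliation_of U f = (\<lambda>x. connected_component_set {y \<in> U. f y = f x} x) ` U"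

definition first_integral_on ::
  "(real^'n) set \<Rightarrow> (real^'n) set set \<Rightarrow> (real^'n \<Rightarrow> real) \<Rightarrow> bool" where
  "first_integral_on U F g \<longleftrightarrow> submersion_on U g \<and> F = foliation_of U g"

text \<open>
  A web of codimension 1, given by the family \<open>W\<close> of its first integrals.  Transversality of
  \<open>n\<close> of the foliations at a point is linear independence of the differentials of the
  corresponding first integrals.
\<close>

definition web_on :: "(real^'n) set \<Rightarrow> ('k \<Rightarrow> real^'n \<Rightarrow> real) \<Rightarrow> bool" where
  "web_on U W \<longleftrightarrow>
     (\<forall>k. submersion_on U (W k)) \<and>
     (\<forall>K. card K = CARD('n) \<longrightarrow>
        (\<forall>x\<in>U. \<forall>c. (\<Sum>k\<in>K. c k *\<^sub>R gradient (W k) x) = 0 \<longrightarrow> (\<forall>k\<in>K. c k = 0)))"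

text \<open>The family \<open>(x\<^sub>1, \<dots>, x\<^sub>n, f)\<close>; the index \<open>None\<close> stands for \<open>f\<close>.\<close>

definition coordinate_web :: "(real^'n \<Rightarrow> real) \<Rightarrow> 'n option \<Rightarrow> real^'n \<Rightarrow> real" where
  "coordinate_web f k = (case k of None \<Rightarrow> f | Some i \<Rightarrow> (\<lambda>x. x $ i))"

definition analytic_coordinates_on :: "(real^'n) set \<Rightarrow> (real^'n \<Rightarrow> real^'n) \<Rightarrow> bool" where
  "analytic_coordinates_on V \<Phi> \<longleftrightarrow>
     real_analytic_on V \<Phi> \<and> inj_on \<Phi> V \<and> open (\<Phi> ` V) \<and>
     real_analytic_on (\<Phi> ` V) (inv_into V \<Phi>)"

text \<open>Parallelizability near the origin of a web defined on a neighbourhood \<open>U\<close> of the origin.\<close>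

definition parallelizable :: "(real^'n) set \<Rightarrow> ('k \<Rightarrow> real^'n \<Rightarrow> real) \<Rightarrow> bool" where
  "parallelizable U W \<longleftrightarrow>
     (\<exists>V \<Phi>. open V \<and> 0 \<in> V \<and> V \<subseteq> U \<and> analytic_coordinates_on V \<Phi> \<and>
        (\<forall>k. \<exists>l. linear l \<and> first_integral_on V (foliation_of V (W k)) (l \<circ> \<Phi>)))"

text \<open>
  Infinitesimal isomorphisms of \<open>(x\<^sub>1, \<dots>, x\<^sub>n, f)\<close>.  The \<open>i\<close>-th component of \<open>X\<close> depends on
  \<open>x\<^sub>i\<close> only, and \<open>X \<bullet> gradient f\<close> is the derivative of \<open>f\<close> along \<open>X\<close>.
\<close>

definition infinitesimal_isomorphism_on ::
  "(real^'n) set \<Rightarrow> (real^'n \<Rightarrow> real) \<Rightarrow> (real^'n \<Rightarrow> real^'n) \<Rightarrow> bool" where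
  "infinitesimal_isomorphism_on U f X \<longleftrightarrow>
     real_analytic_on U X \<and>
     (\<exists>\<xi> :: 'n \<Rightarrow> real \<Rightarrow> real.
        (\<forall>i. real_analytic_on ((\<lambda>x. x $ i) ` U) (\<xi> i)) \<and>
        (\<forall>x\<in>U. X x = (\<chi> i. \<xi> i (x $ i)))) \<and>
     (\<exists>\<phi> :: real \<Rightarrow> real. real_analytic_on (f ` U) \<phi> \<and>
        (\<forall>x\<in>U. X x \<bullet> gradient f x = \<phi> (f x)))"

end

theory Submission
  imports Defs "HOL-Complex_Analysis.Complex_Analysis"
begin

text \<open>
  Write \<open>X = \<Sum>\<^sub>i \<xi>\<^sub>i(x\<^sub>i) \<partial>\<^sub>i\<close> with \<open>X\<cdot>f = \<phi>(f)\<close> and let \<open>k\<close> be the vanishing order of \<open>\<phi>\<close> at \<open>f(0)\<close>.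
  On the coordinate axes the equation determines \<open>\<xi>\<^sub>i\<close> from \<open>\<phi>\<close>, so \<open>k\<close> is finite, and comparing
  leading terms along the vector with \<open>i\<close>-th entry \<open>1 / \<partial>\<^sub>if(0)\<close> gives \<open>n = n\<^sup>k\<close>, hence \<open>k = 1\<close> for
  \<open>n \<ge> 2\<close> (for \<open>n = 1\<close> there is nothing to prove). A field with a simple zero on
  the line is linearizable: there is an analytic coordinate \<open>g\<close> with \<open>\<phi> g' = \<mu> g\<close> and
  \<open>\<mu> \<noteq> 0\<close>. In the coordinates \<open>h\<^sub>i(x\<^sub>i) = g(f(0, \<dots>, x\<^sub>i, \<dots>, 0))\<close> the field \<open>X\<close> is
  \<open>\<mu>\<close> times the Euler field, so \<open>g \<circ> f\<close> is homogeneous of degree 1 and differentiable at the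
  origin, that is linear: \<open>g \<circ> f = \<Sum>\<^sub>i h\<^sub>i(x\<^sub>i)\<close>.
\<close>

no_notation fps_nth (infixl \<open>$\<close> 75)

section \<open>Power series in several variables\<close>

text \<open>Of the several-variable function \<open>f\<close> only three things enter: its
  restriction to the axes, its differentiability and the continuity of its gradient. All other
  analysis happens in one variable, where a real power series extends to a holomorphic function, so
  that composition, inversion, factorization at a zero and primitives come from complex analysis;
  real parts lead back. For the same reason the linearity of g o f in the coordinates h_i is not
  read off from a power series in n variables. It is obtained one ray at a time: there the equation
  X.f = phi(f) becomes G' = G / t, and the chain rule at the origin fixes the constant. The order k
  is finite because no partial derivative of f vanishes: if phi were zero near f(0), each xi_i would
  be zero near 0, and so would X. The identity n = n^k compares two leading coefficients. Let v be
  the sum of the axis vectors along which f has derivative 1. On v each xi_i contributes one copy of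
  the leading coefficient of phi, n in all, whereas f grows n times as fast along v as along a
  summand, so phi(f) contributes n^k copies.\<close>

definition single_index :: "'a::euclidean_space \<Rightarrow> nat \<Rightarrow> 'a \<Rightarrow> nat" where
  "single_index e n = (\<lambda>b\<in>Basis. if b = e then n else 0)"

lemma single_index_PiE: "single_index e n \<in> Basis \<rightarrow>\<^sub>E UNIV"
  by (auto simp: single_index_def)

text \<open>Membership in \<open>Basis \<rightarrow>\<^sub>E UNIV\<close> fixes the value outside
  \<open>Basis\<close>; this is why \<open>single_index\<close> is a restricted function and why a
  genuine equality results.\<close>

lemma single_index_eqI:
  assumes "\<alpha> \<in> Basis \<rightarrow>\<^sub>E UNIV" and "\<forall>b\<in>Basis - {e}. \<alpha> b = 0"
  shows "\<alpha> = single_index e (\<alpha> e)"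
  using assms by (auto simp: single_index_def fun_eq_iff PiE_iff extensional_def)

lemma inj_single_index: "e \<in> Basis \<Longrightarrow> inj (single_index e)"
  by (rule injI) (drule fun_cong[of _ _ e], simp add: single_index_def)

lemma monomial_single_index:
  fixes x :: "'a::euclidean_space"
  assumes "e \<in> Basis"
  shows "(\<Prod>b\<in>Basis. (x \<bullet> b) ^ single_index e n b) = (x \<bullet> e) ^ n"
proof -
  have "(\<Prod>b\<in>Basis. (x \<bullet> b) ^ single_index e n b) = (\<Prod>b\<in>Basis. if b = e then (x \<bullet> e) ^ n else 1)"
    by (intro prod.cong) (auto simp: single_index_def)
  then show ?thesis
    using assms by simp
qed

text \<open>The bridge between multi-index series and series in one variable: terms off the pure
  powers of one coordinate are dropped, the rest is reindexed along an injection.\<close>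

lemma has_sum_single_index_iff:
  fixes x :: "'a::euclidean_space" and c :: "('a \<Rightarrow> nat) \<Rightarrow> 'b::real_normed_vector"
  assumes e: "e \<in> Basis"
    and zero: "\<And>\<alpha>. \<alpha> \<in> Basis \<rightarrow>\<^sub>E UNIV \<Longrightarrow> \<alpha> \<notin> range (single_index e) \<Longrightarrow>
      (\<Prod>b\<in>Basis. (x \<bullet> b) ^ \<alpha> b) *\<^sub>R c \<alpha> = 0"
  shows "((\<lambda>\<alpha>. (\<Prod>b\<in>Basis. (x \<bullet> b) ^ \<alpha> b) *\<^sub>R c \<alpha>) has_sum s) (Basis \<rightarrow>\<^sub>E UNIV) \<longleftrightarrow>
    ((\<lambda>n. (x \<bullet> e) ^ n *\<^sub>R c (single_index e n)) has_sum s) UNIV" (is "(?t has_sum s) _ \<longleftrightarrow> _")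
proof -
  have "(?t has_sum s) (Basis \<rightarrow>\<^sub>E UNIV) \<longleftrightarrow> (?t has_sum s) (range (single_index e))"
  proof (rule has_sum_cong_neutral)
    show "?t \<alpha> = 0" if "\<alpha> \<in> range (single_index e) - (Basis \<rightarrow>\<^sub>E UNIV)" for \<alpha>
      using that single_index_PiE by blast
  qed (use zero in blast)+
  also have "\<dots> \<longleftrightarrow> (?t \<circ> single_index e has_sum s) UNIV"
    by (intro has_sum_reindex inj_single_index e)
  also have "?t \<circ> single_index e = (\<lambda>n. (x \<bullet> e) ^ n *\<^sub>R c (single_index e n))"
    using e by (simp add: fun_eq_iff monomial_single_index)
  finally show ?thesis .
qed

lemma real_analytic_at_compose_coordinate:
  fixes u :: "real \<Rightarrow> 'b::real_normed_vector" and a e :: "'a::euclidean_space"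
  assumes e: "e \<in> Basis" and r: "0 < r"
    and u: "\<And>x. x \<in> ball (a \<bullet> e) r \<Longrightarrow> ((\<lambda>n. (x - a \<bullet> e) ^ n *\<^sub>R c n) has_sum u x) UNIV"
  shows "real_analytic_at (\<lambda>x. u (x \<bullet> e)) a"
proof -
  \<comment> \<open>The one-variable coefficients are placed on the pure powers of coordinate
    \<open>e\<close>; every other coefficient is 0.\<close>
  define c' where "c' \<alpha> = (if \<alpha> \<in> range (single_index e) then c (\<alpha> e) else 0)" for \<alpha>
  have c'_single: "c' (single_index e n) = c n" for n
    using e by (simp add: c'_def) (simp add: single_index_def)
  have "((\<lambda>\<alpha>. (\<Prod>b\<in>Basis. ((x - a) \<bullet> b) ^ \<alpha> b) *\<^sub>R c' \<alpha>) has_sum u (x \<bullet> e)) (Basis \<rightarrow>\<^sub>E UNIV)"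
    if x: "x \<in> ball a r" for x
  proof (subst has_sum_single_index_iff[OF e])
    have "\<bar>(a - x) \<bullet> e\<bar> < r"
      using Basis_le_norm[OF e, of "a - x"] x by (simp add: dist_norm)
    then have "x \<bullet> e \<in> ball (a \<bullet> e) r"
      by (simp add: dist_real_def inner_diff_left)
    from u[OF this] show "((\<lambda>n. ((x - a) \<bullet> e) ^ n *\<^sub>R c' (single_index e n)) has_sum u (x \<bullet> e)) UNIV"
      by (simp add: c'_single inner_diff_left)
  qed (simp add: c'_def)
  with r show ?thesis
    unfolding real_analytic_at_def by blast
qed

text \<open>The standard basis of the line is {1}, so every multi-index is a single
  exponent.\<close>

lemma real_analytic_at_real_iff:
  fixes u :: "real \<Rightarrow> 'b::real_normed_vector"
  shows "real_analytic_at u a \<longleftrightarrow>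
    (\<exists>c r. 0 < r \<and> (\<forall>x\<in>ball a r. ((\<lambda>n. (x - a) ^ n *\<^sub>R c n) has_sum u x) UNIV))"
proof
  assume "real_analytic_at u a"
  then obtain c r where r: "0 < r" and c: "\<And>x. x \<in> ball a r \<Longrightarrow>
      ((\<lambda>\<alpha>. (\<Prod>b\<in>Basis. ((x - a) \<bullet> b) ^ \<alpha> b) *\<^sub>R c \<alpha>) has_sum u x) (Basis \<rightarrow>\<^sub>E UNIV)"
    unfolding real_analytic_at_def by blast
  have "((\<lambda>n. (x - a) ^ n *\<^sub>R c (single_index 1 n)) has_sum u x) UNIV" if x: "x \<in> ball a r" for x
  proof -
    have "\<alpha> \<in> range (single_index 1)" if "\<alpha> \<in> Basis \<rightarrow>\<^sub>E UNIV" for \<alpha> :: "real \<Rightarrow> nat"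
      using single_index_eqI[OF that, of 1] by auto
    then show ?thesis
      using c[OF x] by (subst (asm) has_sum_single_index_iff[of 1]) auto
  qed
  with r show "\<exists>c r. 0 < r \<and> (\<forall>x\<in>ball a r. ((\<lambda>n. (x - a) ^ n *\<^sub>R c n) has_sum u x) UNIV)"
    by (intro exI[of _ "\<lambda>n. c (single_index 1 n)"] exI[of _ r]) auto
next
  assume "\<exists>c r. 0 < r \<and> (\<forall>x\<in>ball a r. ((\<lambda>n. (x - a) ^ n *\<^sub>R c n) has_sum u x) UNIV)"
  then show "real_analytic_at u a"
    using real_analytic_at_compose_coordinate[of 1 _ a _ u] by (auto simp: Ball_def)
qed

lemma real_analytic_at_coordinate:
  fixes u :: "real \<Rightarrow> 'b::real_normed_vector" and a :: "'a::euclidean_space"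
  assumes "e \<in> Basis" and "real_analytic_at u (a \<bullet> e)"
  shows "real_analytic_at (\<lambda>x. u (x \<bullet> e)) a"
proof -
  obtain c r where "0 < r" "\<And>x. x \<in> ball (a \<bullet> e) r \<Longrightarrow>
      ((\<lambda>n. (x - a \<bullet> e) ^ n *\<^sub>R c n) has_sum u x) UNIV"
    using assms(2) unfolding real_analytic_at_real_iff by blast
  then show ?thesis
    by (rule real_analytic_at_compose_coordinate[OF assms(1)])
qed

text \<open>On a line parallel to a basis vector each monomial involving another coordinate has a
  factor 0, so the series restricts termwise without regrouping.\<close>

lemma real_analytic_at_along_axis:
  fixes f :: "'a::euclidean_space \<Rightarrow> 'b::real_normed_vector"
  assumes e: "e \<in> Basis" and "real_analytic_at f a"
  shows "real_analytic_at (\<lambda>t. f (a + t *\<^sub>R e)) 0"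
proof -
  obtain c r where r: "0 < r" and c: "\<And>x. x \<in> ball a r \<Longrightarrow>
      ((\<lambda>\<alpha>. (\<Prod>b\<in>Basis. ((x - a) \<bullet> b) ^ \<alpha> b) *\<^sub>R c \<alpha>) has_sum f x) (Basis \<rightarrow>\<^sub>E UNIV)"
    using assms(2) unfolding real_analytic_at_def by blast
  have "((\<lambda>n. (t - 0) ^ n *\<^sub>R c (single_index e n)) has_sum f (a + t *\<^sub>R e)) UNIV"
    if t: "t \<in> ball 0 r" for t
  proof -
    have "(\<Prod>b\<in>Basis. (t *\<^sub>R e \<bullet> b) ^ \<alpha> b) *\<^sub>R c \<alpha> = 0"
      if \<alpha>: "\<alpha> \<in> Basis \<rightarrow>\<^sub>E UNIV" "\<alpha> \<notin> range (single_index e)" for \<alpha>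
    proof -
      obtain b where "b \<in> Basis" "b \<noteq> e" "\<alpha> b \<noteq> 0"
        using single_index_eqI[OF \<alpha>(1), of e] \<alpha>(2) by blast
      then have "(t *\<^sub>R e \<bullet> b) ^ \<alpha> b = 0"
        using e by (simp add: inner_not_same_Basis)
      then have "(\<Prod>b\<in>Basis. (t *\<^sub>R e \<bullet> b) ^ \<alpha> b) = 0"
        using \<open>b \<in> Basis\<close> by (metis finite_Basis prod_zero)
      then show ?thesis by simp
    qed
    moreover have "a + t *\<^sub>R e \<in> ball a r"
      using e t by (simp add: dist_norm)
    ultimately show ?thesis
      using c[of "a + t *\<^sub>R e"] has_sum_single_index_iff[of e "t *\<^sub>R e" c "f (a + t *\<^sub>R e)"] e
      by simp
  qed
  with r show ?thesis
    unfolding real_analytic_at_real_iff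
    by (intro exI[of _ "\<lambda>n. c (single_index e n)"] exI[of _ r]) auto
qed

section \<open>Linear combinations and locality of analytic functions\<close>

lemma real_analytic_at_zero: "real_analytic_at (\<lambda>x. 0) a"
  unfolding real_analytic_at_def
  by (rule exI[of _ "\<lambda>\<alpha>. 0"], rule exI[of _ 1]) simp

lemma real_analytic_at_add:
  assumes "real_analytic_at f a" and "real_analytic_at g a"
  shows "real_analytic_at (\<lambda>x. f x + g x) a"
proof -
  let ?m = "\<lambda>x \<alpha>. \<Prod>b\<in>Basis. ((x - a) \<bullet> b) ^ \<alpha> b"
  obtain c r where r: "0 < r" and c: "\<And>x. x \<in> ball a r \<Longrightarrow>
      ((\<lambda>\<alpha>. ?m x \<alpha> *\<^sub>R c \<alpha>) has_sum f x) (Basis \<rightarrow>\<^sub>E UNIV)"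
    using assms(1) unfolding real_analytic_at_def by blast
  obtain d s where s: "0 < s" and d: "\<And>x. x \<in> ball a s \<Longrightarrow>
      ((\<lambda>\<alpha>. ?m x \<alpha> *\<^sub>R d \<alpha>) has_sum g x) (Basis \<rightarrow>\<^sub>E UNIV)"
    using assms(2) unfolding real_analytic_at_def by blast
  have "((\<lambda>\<alpha>. ?m x \<alpha> *\<^sub>R (c \<alpha> + d \<alpha>)) has_sum (f x + g x)) (Basis \<rightarrow>\<^sub>E UNIV)"
    if "x \<in> ball a (min r s)" for x
    using has_sum_add[OF c d, of x x] that by (simp add: scaleR_add_right)
  with r s show ?thesis
    unfolding real_analytic_at_def
    by (intro exI[of _ "\<lambda>\<alpha>. c \<alpha> + d \<alpha>"] exI[of _ "min r s"]) simp
qed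

lemma real_analytic_at_sum:
  assumes "\<And>i. i \<in> I \<Longrightarrow> real_analytic_at (f i) a"
  shows "real_analytic_at (\<lambda>x. \<Sum>i\<in>I. f i x) a"
  using assms
  by (induction I rule: infinite_finite_induct)
    (auto simp: real_analytic_at_zero real_analytic_at_add)

lemma real_analytic_at_scaleR_left:
  fixes u :: "'a::euclidean_space \<Rightarrow> real"
  assumes "real_analytic_at u a"
  shows "real_analytic_at (\<lambda>x. u x *\<^sub>R v) a"
proof -
  obtain c r where "0 < r" and c: "\<And>x. x \<in> ball a r \<Longrightarrow>
      ((\<lambda>\<alpha>. (\<Prod>b\<in>Basis. ((x - a) \<bullet> b) ^ \<alpha> b) *\<^sub>R c \<alpha>) has_sum u x) (Basis \<rightarrow>\<^sub>E UNIV)"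
    using assms unfolding real_analytic_at_def by blast
  moreover have "((\<lambda>\<alpha>. (\<Prod>b\<in>Basis. ((x - a) \<bullet> b) ^ \<alpha> b) *\<^sub>R (c \<alpha> *\<^sub>R v)) has_sum u x *\<^sub>R v)
      (Basis \<rightarrow>\<^sub>E UNIV)" if "x \<in> ball a r" for x
    using has_sum_bounded_linear[OF bounded_linear_scaleR_left c[OF that], of v] by simp
  ultimately show ?thesis
    unfolding real_analytic_at_def
    by (intro exI[of _ "\<lambda>\<alpha>. c \<alpha> *\<^sub>R v"] exI[of _ r]) blast
qed

lemma real_analytic_at_cong:
  assumes "real_analytic_at f a" and "\<forall>\<^sub>F x in nhds a. f x = g x"
  shows "real_analytic_at g a"
proof -
  obtain d where d: "0 < d" "\<And>x. x \<in> ball a d \<Longrightarrow> f x = g x"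
    using assms(2) unfolding eventually_nhds_metric by (auto simp: dist_commute)
  obtain c r where r: "0 < r" and c: "\<And>x. x \<in> ball a r \<Longrightarrow>
      ((\<lambda>\<alpha>. (\<Prod>b\<in>Basis. ((x - a) \<bullet> b) ^ \<alpha> b) *\<^sub>R c \<alpha>) has_sum f x) (Basis \<rightarrow>\<^sub>E UNIV)"
    using assms(1) unfolding real_analytic_at_def by blast
  show ?thesis
    unfolding real_analytic_at_def
  proof (intro exI conjI ballI)
    show "0 < min d r" using d r by simp
    fix x assume "x \<in> ball a (min d r)"
    then show "((\<lambda>\<alpha>. (\<Prod>b\<in>Basis. ((x - a) \<bullet> b) ^ \<alpha> b) *\<^sub>R c \<alpha>) has_sum g x) (Basis \<rightarrow>\<^sub>E UNIV)"
      using c[of x] d(2)[of x] by simp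
  qed
qed

section \<open>Differentiability\<close>

text \<open>This is the mean value bound k m^(k-1) D, multiplied by \<open>m\<close> so that the
  exponent k - 1 does not occur.\<close>

lemma power_diff_bound:
  fixes x y m D :: real
  assumes "\<bar>x\<bar> \<le> m" "\<bar>y\<bar> \<le> m" "\<bar>x - y\<bar> \<le> D"
  shows "m * \<bar>x ^ k - y ^ k\<bar> \<le> real k * m ^ k * D"
proof (induction k)
  case (Suc k)
  have m: "0 \<le> m" and D: "0 \<le> D"
    using assms by linarith+
  have "x ^ Suc k - y ^ Suc k = x * (x ^ k - y ^ k) + (x - y) * y ^ k"
    by (simp add: algebra_simps)
  then have "\<bar>x ^ Suc k - y ^ Suc k\<bar> \<le> \<bar>x\<bar> * \<bar>x ^ k - y ^ k\<bar> + \<bar>x - y\<bar> * \<bar>y\<bar> ^ k"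
    by (simp only: abs_mult[symmetric] power_abs[symmetric] abs_triangle_ineq)
  also have "\<dots> \<le> m * \<bar>x ^ k - y ^ k\<bar> + D * m ^ k"
    using assms m D by (intro add_mono mult_mono power_mono) auto
  finally have "m * \<bar>x ^ Suc k - y ^ Suc k\<bar> \<le> m * (m * \<bar>x ^ k - y ^ k\<bar> + D * m ^ k)"
    using m by (rule mult_left_mono)
  also have "\<dots> \<le> m * (real k * m ^ k * D + D * m ^ k)"
    using Suc m by (intro mult_left_mono add_right_mono)
  finally show ?case
    by (simp add: algebra_simps)
qed simp

lemma monomial_bound:
  fixes y :: "'b \<Rightarrow> real"
  assumes "finite B" "\<And>b. b \<in> B \<Longrightarrow> \<bar>y b\<bar> \<le> m"
  shows "\<bar>\<Prod>b\<in>B. y b ^ \<alpha> b\<bar> \<le> m ^ (\<Sum>b\<in>B. \<alpha> b)"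
proof -
  have "\<bar>\<Prod>b\<in>B. y b ^ \<alpha> b\<bar> = (\<Prod>b\<in>B. \<bar>y b\<bar> ^ \<alpha> b)"
    by (simp add: abs_prod power_abs)
  also have "\<dots> \<le> (\<Prod>b\<in>B. m ^ \<alpha> b)"
    using assms by (intro prod_mono conjI power_mono) auto
  finally show ?thesis
    by (simp add: power_sum)
qed

text \<open>One variable is exchanged at a time, by x^k P - y^k Q = x^k (P - Q) + (x^k - y^k) Q. The
  factor \<open>m\<close> again stands in for lowering the exponent by one.\<close>

lemma monomial_diff_bound:
  fixes x y :: "'b \<Rightarrow> real"
  assumes "finite B" "0 \<le> m" "\<And>b. b \<in> B \<Longrightarrow> \<bar>x b\<bar> \<le> m" "\<And>b. b \<in> B \<Longrightarrow> \<bar>y b\<bar> \<le> m"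
    and "0 \<le> D" "\<And>b. b \<in> B \<Longrightarrow> \<bar>x b - y b\<bar> \<le> D"
  shows "m * \<bar>(\<Prod>b\<in>B. x b ^ \<alpha> b) - (\<Prod>b\<in>B. y b ^ \<alpha> b)\<bar>
    \<le> real (\<Sum>b\<in>B. \<alpha> b) * m ^ (\<Sum>b\<in>B. \<alpha> b) * D"
  using assms(1,3,4,6)
proof (induction B rule: finite_induct)
  case (insert b B)
  let ?k = "\<alpha> b" and ?N = "\<Sum>b\<in>B. \<alpha> b"
  let ?P = "\<Prod>b\<in>B. x b ^ \<alpha> b" and ?Q = "\<Prod>b\<in>B. y b ^ \<alpha> b"
  have IH: "m * \<bar>?P - ?Q\<bar> \<le> real ?N * m ^ ?N * D"
    using insert by simp
  have x: "\<bar>x b ^ ?k\<bar> \<le> m ^ ?k"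
    using insert.prems by (simp add: power_abs power_mono)
  have Q: "\<bar>?Q\<bar> \<le> m ^ ?N"
    using insert by (intro monomial_bound) auto
  have d: "m * \<bar>x b ^ ?k - y b ^ ?k\<bar> \<le> real ?k * m ^ ?k * D"
    using insert.prems by (intro power_diff_bound) auto
  have "x b ^ ?k * ?P - y b ^ ?k * ?Q = x b ^ ?k * (?P - ?Q) + (x b ^ ?k - y b ^ ?k) * ?Q"
    by (simp add: algebra_simps)
  then have "\<bar>x b ^ ?k * ?P - y b ^ ?k * ?Q\<bar>
      \<le> \<bar>x b ^ ?k\<bar> * \<bar>?P - ?Q\<bar> + \<bar>x b ^ ?k - y b ^ ?k\<bar> * \<bar>?Q\<bar>"
    by (simp only: abs_mult[symmetric] abs_triangle_ineq)
  then have "m * \<bar>x b ^ ?k * ?P - y b ^ ?k * ?Q\<bar>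
      \<le> m * (\<bar>x b ^ ?k\<bar> * \<bar>?P - ?Q\<bar> + \<bar>x b ^ ?k - y b ^ ?k\<bar> * \<bar>?Q\<bar>)"
    using assms(2) by (rule mult_left_mono)
  also have "\<dots> = \<bar>x b ^ ?k\<bar> * (m * \<bar>?P - ?Q\<bar>) + (m * \<bar>x b ^ ?k - y b ^ ?k\<bar>) * \<bar>?Q\<bar>"
    by (simp add: algebra_simps)
  also have "\<dots> \<le> m ^ ?k * (real ?N * m ^ ?N * D) + (real ?k * m ^ ?k * D) * m ^ ?N"
    using assms(2,5) by (intro add_mono mult_mono x IH d Q) auto
  also have "\<dots> = real (?k + ?N) * m ^ (?k + ?N) * D"
    by (simp add: algebra_simps power_add)
  finally show ?case
    using insert.hyps by simp
qed simp

text \<open>Since k + 2 \<le> 2 * 2^k, the geometric decay absorbs the degree. The square matters: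
  after division by a radius proportional to \<open>s\<close>, one factor \<open>s\<close> is left
  to make the Lipschitz constant small, uniformly in the degree.\<close>

lemma nat_times_power_le:
  fixes s :: real
  assumes "0 \<le> s" "s \<le> 1 / 2" "2 \<le> N"
  shows "real N * s ^ N \<le> 2 * s\<^sup>2"
proof -
  obtain k where N: "N = k + 2"
    using assms(3) by (metis add.commute le_Suc_ex)
  have "k + 2 \<le> 2 * 2 ^ k"
    by (induction k) auto
  then have "real (k + 2) \<le> 2 * 2 ^ k"
    by (metis of_nat_le_iff of_nat_mult of_nat_numeral of_nat_power)
  moreover have "s ^ k \<le> (1 / 2) ^ k"
    using assms by (intro power_mono) auto
  ultimately have "real (k + 2) * s ^ k \<le> (2 * 2 ^ k) * (1 / 2) ^ k"
    using assms by (intro mult_mono) auto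
  also have "\<dots> = 2"
    by (simp add: power_one_over)
  finally have "(real (k + 2) * s ^ k) * s\<^sup>2 \<le> 2 * s\<^sup>2"
    by (rule mult_right_mono) simp
  then show ?thesis
    by (simp only: N power_add mult.assoc)
qed

lemma multi_index_sum_1:
  assumes "\<alpha> \<in> (Basis :: 'a::euclidean_space set) \<rightarrow>\<^sub>E UNIV" "(\<Sum>b\<in>Basis. \<alpha> b) = 1"
  shows "\<exists>e\<in>Basis. \<alpha> = single_index e 1"
proof -
  obtain e where "e \<in> Basis" "\<alpha> e = 1" "\<forall>b\<in>Basis. e \<noteq> b \<longrightarrow> \<alpha> b = 0"
    using assms(2) sum_eq_1_iff[of Basis \<alpha>] by auto
  then show ?thesis
    using single_index_eqI[OF assms(1), of e] by (metis DiffE singletonI)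
qed

text \<open>Each monomial of degree at least 2 is Lipschitz on the ball of radius \<open>s * \<rho>\<close>, with a
  constant of order \<open>s\<close> times its value at the point with all coordinates equal to \<open>\<rho>\<close>.\<close>

lemma real_analytic_at_strict_derivative:
  fixes f :: "'a::euclidean_space \<Rightarrow> real"
  assumes "real_analytic_at f a"
  obtains L where "bounded_linear L"
    and "\<And>\<epsilon>. 0 < \<epsilon> \<Longrightarrow> \<exists>\<delta>>0. \<forall>x\<in>ball a \<delta>. \<forall>y\<in>ball a \<delta>. \<bar>f x - f y - L (x - y)\<bar> \<le> \<epsilon> * norm (x - y)"
proof -
  let ?I = "Basis \<rightarrow>\<^sub>E UNIV :: ('a \<Rightarrow> nat) set"
  let ?m = "\<lambda>x \<alpha>. \<Prod>b\<in>Basis. (x \<bullet> b) ^ \<alpha> b"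
  let ?deg = "\<lambda>\<alpha>. \<Sum>b\<in>Basis. \<alpha> b"
  obtain c r where r: "0 < r" and c: "\<And>x. x \<in> ball a r \<Longrightarrow>
      ((\<lambda>\<alpha>. ?m (x - a) \<alpha> * c \<alpha>) has_sum f x) ?I"
    using assms unfolding real_analytic_at_def real_scaleR_def by blast
  define w :: 'a where "w = (\<Sum>b\<in>Basis. b)"
  \<comment> \<open>The denominator puts the point with all coordinates \<open>\<rho>\<close> from
    \<open>a\<close> inside the ball and also keeps \<open>\<rho> \<le> r\<close>. At that point a
    monomial depends on its degree alone.\<close>
  define \<rho> where "\<rho> = r / (2 + norm w)"
  have \<rho>: "0 < \<rho>" "\<rho> \<le> r" "\<rho> * norm w < r"
  proof -
    have "0 < 2 + norm w"
      by (simp add: add_pos_nonneg)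
    then show "0 < \<rho>" "\<rho> \<le> r" "\<rho> * norm w < r"
      using r by (simp_all add: \<rho>_def divide_le_eq divide_less_eq algebra_simps)
  qed
  have wb: "w \<bullet> b = 1" if "b \<in> Basis" for b
    using that by (simp add: w_def inner_sum_left inner_Basis)
  have "a + \<rho> *\<^sub>R w \<in> ball a r"
    using \<rho> by (simp add: dist_norm)
  from c[OF this] have "(\<lambda>\<alpha>. \<rho> ^ ?deg \<alpha> * c \<alpha>) summable_on ?I"
    by (simp add: wb power_sum has_sum_imp_summable)
  \<comment> \<open>Unconditional convergence of a real series is absolute convergence;
    \<open>T\<close> is the resulting majorant.\<close>
  then have "(\<lambda>\<alpha>. \<rho> ^ ?deg \<alpha> * \<bar>c \<alpha>\<bar>) summable_on ?I"
    using \<rho>(1) by (subst (asm) summable_on_iff_abs_summable_on_real) (simp add: abs_mult)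
  then obtain T where T: "((\<lambda>\<alpha>. \<rho> ^ ?deg \<alpha> * \<bar>c \<alpha>\<bar>) has_sum T) ?I"
    using summable_on_def by blast
  have T0: "0 \<le> T"
    using \<rho>(1) by (intro has_sum_nonneg[OF T]) auto
  \<comment> \<open>The derivative is the degree 1 part of the series.\<close>
  define L where "L z = (\<Sum>e\<in>Basis. (z \<bullet> e) * c (single_index e 1))" for z :: 'a
  have L: "bounded_linear L"
    unfolding L_def
    by (intro bounded_linear_sum bounded_linear_mult_left[THEN bounded_linear_compose] bounded_linear_inner_left)
  define S where "S = (\<lambda>e::'a. single_index e 1) ` Basis"
  have S: "S \<subseteq> ?I" "finite S"
    by (auto simp: S_def single_index_def)
  have inj: "inj_on (\<lambda>e::'a. single_index e 1) Basis"
    by (rule inj_onI, drule fun_cong) (auto simp: single_index_def split: if_splits)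
  have bound: "\<bar>f x - f y - L (x - y)\<bar> \<le> 2 * s / \<rho> * T * norm (x - y)"
    if s: "0 < s" "s \<le> 1 / 2" and x: "x \<in> ball a (s * \<rho>)" and y: "y \<in> ball a (s * \<rho>)" for s x y
  proof -
    let ?d = "\<lambda>\<alpha>. ?m (x - a) \<alpha> * c \<alpha> - ?m (y - a) \<alpha> * c \<alpha>"
    have "s * \<rho> \<le> r"
      using s \<rho> mult_mono[of s 1 \<rho> r] by simp
    then have "x \<in> ball a r" "y \<in> ball a r"
      using x y by auto
    then have "(?d has_sum (f x - f y)) ?I"
      using has_sum_add[OF c[of x] has_sum_cmult_right[OF c[of y], of "- 1"]] by simp
    moreover have "(?d has_sum L (x - y)) S"
    proof (rule has_sum_finiteI[OF S(2)])
      have "sum ?d S = (\<Sum>e\<in>Basis. ?d (single_index e 1))"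
        unfolding S_def by (subst sum.reindex[OF inj]) (simp add: o_def)
      also have "\<dots> = L (x - y)"
        unfolding L_def
        by (intro sum.cong refl)
          (simp add: monomial_single_index left_diff_distrib[symmetric] inner_diff_left[symmetric])
      finally show "L (x - y) = sum ?d S" by simp
    qed
    \<comment> \<open>Removing \<open>S\<close> subtracts exactly the linear part. What remains is
      the constant term, which cancels in the difference, and the monomials of degree at least
      2.\<close>
    ultimately have 1: "(?d has_sum (f x - f y - L (x - y))) (?I - S)"
      using S(1) by (rule has_sum_Diff)
    have "(\<lambda>\<alpha>. \<rho> ^ ?deg \<alpha> * \<bar>c \<alpha>\<bar>) summable_on (?I - S)"
      using T by (meson Diff_subset has_sum_imp_summable summable_on_subset_banach)
    then obtain T' where T': "((\<lambda>\<alpha>. \<rho> ^ ?deg \<alpha> * \<bar>c \<alpha>\<bar>) has_sum T') (?I - S)"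
      using summable_on_def by blast
    have "T' \<le> T"
      using \<rho>(1) by (intro has_sum_mono2[OF T' T]) auto
    have 2: "((\<lambda>\<alpha>. 2 * s / \<rho> * norm (x - y) * (\<rho> ^ ?deg \<alpha> * \<bar>c \<alpha>\<bar>)) has_sum
        (2 * s / \<rho> * norm (x - y) * T')) (?I - S)"
      using T' by (rule has_sum_cmult_right)
    have "norm (f x - f y - L (x - y)) \<le> 2 * s / \<rho> * norm (x - y) * T'"
    proof (rule norm_infsum_le[OF 1 2])
      fix \<alpha> assume \<alpha>: "\<alpha> \<in> ?I - S"
      let ?D = "\<bar>?m (x - a) \<alpha> - ?m (y - a) \<alpha>\<bar>"
      have "(s * \<rho>) * ?D \<le> real (?deg \<alpha>) * (s * \<rho>) ^ ?deg \<alpha> * norm (x - y)"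
      proof (rule monomial_diff_bound)
        fix b :: 'a assume b: "b \<in> Basis"
        show "\<bar>(x - a) \<bullet> b\<bar> \<le> s * \<rho>" "\<bar>(y - a) \<bullet> b\<bar> \<le> s * \<rho>"
          using Basis_le_norm[OF b, of "x - a"] Basis_le_norm[OF b, of "y - a"] x y
          by (auto simp: dist_norm norm_minus_commute)
        show "\<bar>(x - a) \<bullet> b - (y - a) \<bullet> b\<bar> \<le> norm (x - y)"
          using Basis_le_norm[OF b, of "x - y"] by (simp add: inner_diff_left)
      qed (use s \<rho> in auto)
      also have "\<dots> = (real (?deg \<alpha>) * s ^ ?deg \<alpha>) * (\<rho> ^ ?deg \<alpha> * norm (x - y))"
        by (simp add: power_mult_distrib)
      also have "\<dots> \<le> (2 * s\<^sup>2) * (\<rho> ^ ?deg \<alpha> * norm (x - y))"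
      proof (intro mult_right_mono)
        have "?deg \<alpha> \<noteq> 1"
          using \<alpha> multi_index_sum_1[of \<alpha>] by (auto simp: S_def)
        then consider "?deg \<alpha> = 0" | "2 \<le> ?deg \<alpha>"
          by linarith
        then show "real (?deg \<alpha>) * s ^ ?deg \<alpha> \<le> 2 * s\<^sup>2"
        proof cases
          case 2
          then show ?thesis
            using s by (intro nat_times_power_le) auto
        qed simp
      qed (use \<rho> in auto)
      finally have "?D \<le> 2 * s / \<rho> * norm (x - y) * \<rho> ^ ?deg \<alpha>"
        using s \<rho> by (simp add: field_simps power2_eq_square)
      then have "?D * \<bar>c \<alpha>\<bar> \<le> 2 * s / \<rho> * norm (x - y) * \<rho> ^ ?deg \<alpha> * \<bar>c \<alpha>\<bar>"
        by (rule mult_right_mono) simp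
      then show "norm (?d \<alpha>) \<le> 2 * s / \<rho> * norm (x - y) * (\<rho> ^ ?deg \<alpha> * \<bar>c \<alpha>\<bar>)"
        by (simp add: left_diff_distrib[symmetric] abs_mult mult.assoc)
    qed
    also have "\<dots> \<le> 2 * s / \<rho> * norm (x - y) * T"
      using \<open>T' \<le> T\<close> s \<rho> by (intro mult_left_mono) auto
    finally show ?thesis
      by (simp add: mult_ac)
  qed
  show thesis
  proof (rule that[OF L])
    fix \<epsilon> :: real assume \<epsilon>: "0 < \<epsilon>"
    \<comment> \<open>The bound 1/2 is the range of \<open>nat_times_power_le\<close>; the other one
      turns the Lipschitz constant into at most \<open>\<epsilon>\<close>. Using T + 1 avoids
      dividing by 0 when \<open>T\<close> is 0.\<close>
    define s where "s = min (1 / 2) (\<epsilon> * \<rho> / (2 * (T + 1)))"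
    have s: "0 < s" "s \<le> 1 / 2" and s': "s \<le> \<epsilon> * \<rho> / (2 * (T + 1))"
    proof -
      show "0 < s"
        using \<epsilon> \<rho>(1) T0 by (simp add: s_def)
      show "s \<le> 1 / 2" "s \<le> \<epsilon> * \<rho> / (2 * (T + 1))"
        unfolding s_def by (rule min.cobounded1, rule min.cobounded2)
    qed
    have "2 * s / \<rho> * T \<le> 2 * s / \<rho> * (T + 1)"
      using s \<rho> by (intro mult_left_mono) auto
    also have "\<dots> \<le> \<epsilon>"
      using s' \<rho> T0 by (simp add: field_simps)
    finally have "2 * s / \<rho> * T * norm z \<le> \<epsilon> * norm z" for z :: 'a
      by (rule mult_right_mono) simp
    then have "\<forall>x\<in>ball a (s * \<rho>). \<forall>y\<in>ball a (s * \<rho>). \<bar>f x - f y - L (x - y)\<bar> \<le> \<epsilon> * norm (x - y)"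
      using bound[OF s] by (meson order_trans)
    then show "\<exists>\<delta>>0. \<forall>x\<in>ball a \<delta>. \<forall>y\<in>ball a \<delta>. \<bar>f x - f y - L (x - y)\<bar> \<le> \<epsilon> * norm (x - y)"
      using s \<rho> by (intro exI[of _ "s * \<rho>"]) auto
  qed
qed

lemma real_analytic_at_imp_differentiable:
  fixes f :: "'a::euclidean_space \<Rightarrow> real"
  assumes "real_analytic_at f a"
  shows "f differentiable at a"
proof -
  obtain L where L: "bounded_linear L" and
    e: "\<And>\<epsilon>. 0 < \<epsilon> \<Longrightarrow> \<exists>\<delta>>0. \<forall>x\<in>ball a \<delta>. \<forall>y\<in>ball a \<delta>. \<bar>f x - f y - L (x - y)\<bar> \<le> \<epsilon> * norm (x - y)"
    by (rule real_analytic_at_strict_derivative[OF assms]) blast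
  have "\<exists>\<delta>>0. \<forall>x. norm (x - a) < \<delta> \<longrightarrow> norm (f x - f a - L (x - a)) \<le> \<epsilon> * norm (x - a)"
    if "0 < \<epsilon>" for \<epsilon>
    using e[OF that] 
    by (elim exE conjE, intro exI conjI) (auto simp: dist_norm norm_minus_commute)
  then have "(f has_derivative L) (at a)"
    using L by (simp add: has_derivative_at_alt)
  then show ?thesis
    by (rule differentiableI)
qed

section \<open>Gradients and their continuity\<close>

lemma has_derivative_gradient:
  fixes f :: "real^'n \<Rightarrow> real"
  assumes "f differentiable at x"
  shows "(f has_derivative (\<lambda>v. gradient f x \<bullet> v)) (at x)"
proof -
  let ?D = "frechet_derivative f (at x)"
  have D: "(f has_derivative ?D) (at x)"
    using assms by (simp add: frechet_derivative_works)
  then have "linear ?D"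
    by (simp add: has_derivative_linear)
  have "?D v = gradient f x \<bullet> v" for v
  proof -
    have "?D v = ?D (\<Sum>i\<in>UNIV. (v $ i) *\<^sub>R axis i 1)"
      by (metis basis_expansion scalar_mult_eq_scaleR)
    also have "\<dots> = (\<Sum>i\<in>UNIV. v $ i * ?D (axis i 1))"
      using \<open>linear ?D\<close> by (simp add: linear_sum linear_cmul)
    finally show ?thesis
      by (simp add: gradient_def inner_vec_def mult.commute)
  qed
  then have "?D = (\<lambda>v. gradient f x \<bullet> v)" ..
  with D show ?thesis by simp
qed

lemma gradient_eqI:
  fixes f :: "real^'n \<Rightarrow> real"
  assumes "(f has_derivative (\<lambda>v. g \<bullet> v)) (at x)"
  shows "gradient f x = g"
proof -
  have "frechet_derivative f (at x) = (\<lambda>v. g \<bullet> v)"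
    using frechet_derivative_at[OF assms] by simp
  then show ?thesis
    by (simp add: gradient_def vec_eq_iff inner_axis)
qed

text \<open>The strict derivative at \<open>a\<close> controls difference quotients between any two
  points near \<open>a\<close>. Passing to the limit at a nearby point \<open>x\<close> bounds its
  partial derivative against \<open>L v\<close>, so continuity follows without differentiating the
  series.\<close>

lemma gradient_tendsto:
  fixes f :: "real^'n \<Rightarrow> real"
  assumes "open U" "a \<in> U" and f: "real_analytic_on U f"
  shows "((\<lambda>x. gradient f x $ i) \<longlongrightarrow> gradient f a $ i) (nhds a)"
proof -
  have "real_analytic_at f a"
    using f assms(2) by (simp add: real_analytic_on_def)
  then obtain L where
    e: "\<And>\<epsilon>. 0 < \<epsilon> \<Longrightarrow> \<exists>\<delta>>0. \<forall>x\<in>ball a \<delta>. \<forall>y\<in>ball a \<delta>. \<bar>f x - f y - L (x - y)\<bar> \<le> \<epsilon> * norm (x - y)"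
      and L: "bounded_linear L"
    by (rule real_analytic_at_strict_derivative) blast
  define v where "v = (axis i 1 :: real^'n)"
  have v: "norm v = 1"
    by (simp add: v_def)
  have near: "\<exists>\<delta>>0. \<forall>x\<in>ball a \<delta>. \<bar>gradient f x $ i - L v\<bar> \<le> \<epsilon>" if \<epsilon>: "0 < \<epsilon>" for \<epsilon>
  proof -
    obtain d where d: "0 < d" "ball a d \<subseteq> U"
      using assms(1,2) open_contains_ball by blast
    obtain d' where d': "0 < d'"
      "\<And>x y. x \<in> ball a d' \<Longrightarrow> y \<in> ball a d' \<Longrightarrow> \<bar>f x - f y - L (x - y)\<bar> \<le> \<epsilon> * norm (x - y)"
      using e[OF \<epsilon>] by blast
    have "\<bar>gradient f x $ i - L v\<bar> \<le> \<epsilon>" if x: "x \<in> ball a (min d d')" for x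
    proof -
      have "f differentiable at x"
        using x d(2) f by (auto intro!: real_analytic_at_imp_differentiable simp: real_analytic_on_def)
      then have "(f has_derivative (\<lambda>v. gradient f x \<bullet> v)) (at (x + 0 *\<^sub>R v))"
        using has_derivative_gradient by simp
      moreover have "((\<lambda>t. x + t *\<^sub>R v) has_derivative (\<lambda>t. t *\<^sub>R v)) (at 0)"
        by (auto intro!: derivative_eq_intros)
      ultimately have "((\<lambda>t. f (x + t *\<^sub>R v)) has_derivative (\<lambda>t. gradient f x \<bullet> t *\<^sub>R v)) (at 0)"
        by (rule has_derivative_compose[rotated])
      then have "((\<lambda>t. f (x + t *\<^sub>R v)) has_real_derivative (gradient f x $ i)) (at 0)"
        by (simp add: has_field_derivative_def v_def inner_axis mult_commute_abs)
      then have lim: "((\<lambda>t. (f (x + t *\<^sub>R v) - f x) / t) \<longlongrightarrow> gradient f x $ i) (at 0)"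
        by (simp add: DERIV_def)
      have "((\<lambda>t. x + t *\<^sub>R v) \<longlongrightarrow> x + 0 *\<^sub>R v) (at 0)"
        by (intro tendsto_intros)
      then have "\<forall>\<^sub>F t in at 0. x + t *\<^sub>R v \<in> ball a (min d d')"
        using x by (intro topological_tendstoD) auto
      then have "\<forall>\<^sub>F t in at 0. \<bar>(f (x + t *\<^sub>R v) - f x) / t - L v\<bar> \<le> \<epsilon>"
        using eventually_neq_at_within[of 0]
      proof eventually_elim
        case (elim t)
        have "\<bar>f (x + t *\<^sub>R v) - f x - L (t *\<^sub>R v)\<bar> \<le> \<epsilon> * \<bar>t\<bar>"
          using d'(2)[of "x + t *\<^sub>R v" x] elim x v by simp
        moreover have "L (t *\<^sub>R v) = t * L v"
          using L by (simp add: linear_simps)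
        moreover have "(f (x + t *\<^sub>R v) - f x) / t - L v = (f (x + t *\<^sub>R v) - f x - t * L v) / t"
          using elim by (simp add: field_simps)
        ultimately show ?case
          using elim by (simp add: abs_divide divide_le_eq)
      qed
      then show ?thesis
        by (intro tendsto_upperbound[OF tendsto_rabs[OF tendsto_diff[OF lim tendsto_const]]]) auto
    qed
    with d(1) d'(1) show ?thesis
      by (intro exI[of _ "min d d'"]) auto
  qed
  \<comment> \<open>The estimate \<open>near\<close> applies to \<open>a\<close> itself; with half
    of the gap as \<open>\<epsilon>\<close> the gap must be 0.\<close>
  have "gradient f a $ i = L v"
  proof (rule ccontr)
    assume "gradient f a $ i \<noteq> L v"
    then have "0 < \<bar>gradient f a $ i - L v\<bar> / 2"
      by simp
    from near[OF this] have "\<bar>gradient f a $ i - L v\<bar> \<le> \<bar>gradient f a $ i - L v\<bar> / 2"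
      by (metis centre_in_ball)
    then show False
      using \<open>gradient f a $ i \<noteq> L v\<close> by simp
  qed
  moreover have "\<exists>\<delta>>0. \<forall>x. dist x a < \<delta> \<longrightarrow> dist (gradient f x $ i) (L v) < \<epsilon>" if "0 < \<epsilon>" for \<epsilon>
  proof -
    obtain \<delta> where "0 < \<delta>" "\<forall>x\<in>ball a \<delta>. \<bar>gradient f x $ i - L v\<bar> \<le> \<epsilon> / 2"
      using near[of "\<epsilon> / 2"] \<open>0 < \<epsilon>\<close> by (meson half_gt_zero)
    then show ?thesis
      using that by (intro exI[of _ \<delta>]) (smt (verit) dist_commute dist_real_def field_sum_of_halves mem_ball)
  qed
  ultimately show ?thesis
    by (auto simp: tendsto_iff eventually_nhds_metric)
qed

section \<open>Analytic functions of one variable\<close>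

text \<open>The same coefficients are summed at complex arguments. Convergence at the real point a +
  k, with k just above the distance of \<open>w\<close> from the centre, forces convergence at
  \<open>w\<close>.\<close>

lemma real_analytic_at_holomorphic_extension:
  fixes u :: "real \<Rightarrow> real"
  assumes "real_analytic_at u a"
  obtains F r where "0 < r" "F holomorphic_on ball (of_real a) r"
    "\<And>x. x \<in> ball a r \<Longrightarrow> F (of_real x) = of_real (u x)"
proof -
  obtain c r where r: "0 < r"
    and c: "\<And>x. x \<in> ball a r \<Longrightarrow> ((\<lambda>n. (x - a) ^ n * c n) has_sum u x) UNIV"
    using assms unfolding real_analytic_at_real_iff real_scaleR_def by blast
  have sums: "(\<lambda>n. c n * (x - a) ^ n) sums u x" if "x \<in> ball a r" for x
    using has_sum_imp_sums[OF c[OF that]] by (simp add: mult.commute)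
  define F :: "complex \<Rightarrow> complex"
    where "F w = (\<Sum>n. of_real (c n) * (w - of_real a) ^ n)" for w
  have "(\<lambda>n. of_real (c n) * (w - of_real a) ^ n) sums F w" if w: "w \<in> ball (of_real a) r" for w
  proof -
    obtain k where k: "cmod (w - of_real a) < k" "k < r"
      using w dense by (metis dist_norm dist_commute mem_ball)
    then have "a + k \<in> ball a r"
      using norm_ge_zero[of "w - of_real a"] by (simp add: dist_real_def del: norm_ge_zero)
    then have "summable (\<lambda>n. c n * k ^ n)"
      using sums[of "a + k"] by (simp add: sums_iff)
    then have "summable (\<lambda>n. complex_of_real (c n) * of_real k ^ n)"
      using summable_of_real[of "\<lambda>n. c n * k ^ n", where 'a = complex] by simp
    then have "summable (\<lambda>n. of_real (c n) * (w - of_real a) ^ n)"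
    proof (rule powser_inside)
      show "cmod (w - of_real a) < cmod (of_real k)"
        using k(1) by (metis norm_of_real abs_ge_self order_less_le_trans)
    qed
    then show ?thesis
      unfolding F_def by (rule summable_sums)
  qed
  then have "F holomorphic_on ball (of_real a) r"
    by (rule power_series_holomorphic)
  moreover have "F (of_real x) = of_real (u x)" if "x \<in> ball a r" for x
    using sums_of_real[OF sums[OF that], where 'a = complex]
    by (simp add: F_def sums_iff)
  ultimately show thesis
    using r that by blast
qed

lemma Re_of_real_mult: "Re (of_real c * z) = c * Re z"
  and Im_of_real_mult: "Im (of_real c * z) = c * Im z"
  by simp_all

text \<open>\<open>F\<close> may take non-real values on the line: as x - a is real, real parts are
  taken coefficient by coefficient. The intermediate radius \<open>k\<close> provides the absolute
  convergence that \<open>has_sum\<close> demands.\<close>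

lemma real_analytic_at_Re_holomorphic:
  fixes u :: "real \<Rightarrow> real"
  assumes "0 < r" and F: "F holomorphic_on ball (of_real a) r"
    and u: "\<And>x. x \<in> ball a r \<Longrightarrow> u x = Re (F (of_real x))"
  shows "real_analytic_at u a"
  unfolding real_analytic_at_real_iff
proof (intro exI conjI ballI)
  fix x assume x: "x \<in> ball a r"
  define d where "d n = (deriv ^^ n) F (of_real a) / fact n" for n
  have d: "(\<lambda>n. d n * (w - of_real a) ^ n) sums F w" if "w \<in> ball (of_real a) r" for w
    unfolding d_def by (rule holomorphic_power_series[OF F that])
  obtain k where k: "\<bar>x - a\<bar> < k" "k < r"
    using x dense by (metis dist_real_def dist_commute mem_ball)
  have "of_real (a + k) \<in> ball (complex_of_real a) r"
    using k by (simp add: dist_norm)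
  then have "summable (\<lambda>n. d n * of_real k ^ n)"
    using d[of "of_real (a + k)"] by (simp add: sums_iff)
  then have abs: "summable (\<lambda>n. norm (d n * (of_real x - of_real a) ^ n))"
  proof (rule powser_insidea)
    show "cmod (of_real x - of_real a) < cmod (of_real k)"
      using k by (metis norm_of_real of_real_diff abs_ge_self order_less_le_trans)
  qed
  have "of_real x \<in> ball (complex_of_real a) r"
    using x by (metis dist_of_real mem_ball)
  then have "((\<lambda>n. d n * (of_real x - of_real a) ^ n) has_sum F (of_real x)) UNIV"
    by (intro norm_summable_imp_has_sum abs d)
  then have "((\<lambda>n. Re (d n * (of_real x - of_real a) ^ n)) has_sum Re (F (of_real x))) UNIV"
    by (rule has_sum_Re)
  moreover have "Re (d n * (of_real x - of_real a) ^ n) = (x - a) ^ n *\<^sub>R Re (d n)" for n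
    by (simp flip: of_real_diff of_real_power)
  ultimately show "((\<lambda>n. (x - a) ^ n *\<^sub>R Re ((deriv ^^ n) F (of_real a) / fact n)) has_sum u x) UNIV"
    using u[OF x] by (simp add: d_def)
qed (fact assms(1))

lemma has_real_derivative_Re_of_real:
  assumes "(F has_field_derivative D) (at (of_real x))"
  shows "((\<lambda>t. Re (F (of_real t))) has_real_derivative Re D) (at x)"
  using has_vector_derivative_real_field[OF assms, of UNIV]
  by (rule has_field_derivative_Re)

text \<open>The expansion is recentred through holomorphy on a smaller disc instead of rearranging
  the series.\<close>

lemma real_analytic_at_imp_eventually:
  fixes u :: "real \<Rightarrow> real"
  assumes "real_analytic_at u a"
  shows "\<forall>\<^sub>F x in nhds a. real_analytic_at u x"
proof -
  obtain F r where r: "0 < r" and F: "F holomorphic_on ball (of_real a) r"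
    "\<And>x. x \<in> ball a r \<Longrightarrow> F (of_real x) = of_real (u x)"
    using real_analytic_at_holomorphic_extension[OF assms] by blast
  have "real_analytic_at u x" if x: "x \<in> ball a r" for x
  proof (rule real_analytic_at_Re_holomorphic)
    show "0 < r - dist a x"
      using x by simp
    have "ball (of_real x) (r - dist a x) \<subseteq> ball (complex_of_real a) r"
      by (simp add: ball_subset_ball_iff dist_of_real) (simp add: dist_commute)
    then show "F holomorphic_on ball (of_real x) (r - dist a x)"
      by (rule holomorphic_on_subset[OF F(1)])
    show "u y = Re (F (of_real y))" if "y \<in> ball x (r - dist a x)" for y
    proof -
      have "y \<in> ball a r"
        using that dist_triangle[of a y x] by simp
      then show ?thesis
        using F(2) by simp
    qed
  qed
  then show ?thesis
    using eventually_nhds_ball[OF r, of a] by (rule eventually_mono[rotated])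
qed

lemma real_analytic_at_compose:
  fixes u g :: "real \<Rightarrow> real"
  assumes "real_analytic_at u a" and "real_analytic_at g (u a)"
  shows "real_analytic_at (\<lambda>x. g (u x)) a"
proof -
  obtain F r where r: "0 < r" and F: "F holomorphic_on ball (of_real a) r"
    "\<And>x. x \<in> ball a r \<Longrightarrow> F (of_real x) = of_real (u x)"
    using real_analytic_at_holomorphic_extension[OF assms(1)] by blast
  obtain G s where s: "0 < s" and G: "G holomorphic_on ball (of_real (u a)) s"
    "\<And>x. x \<in> ball (u a) s \<Longrightarrow> G (of_real x) = of_real (g x)"
    using real_analytic_at_holomorphic_extension[OF assms(2)] by blast
  let ?T = "ball (of_real a) r \<inter> F -` ball (of_real (u a)) s"
  have "open ?T"
    using F(1) by (intro continuous_open_preimage holomorphic_on_imp_continuous_on) auto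
  moreover have "of_real a \<in> ?T"
    using r s F(2)[of a] by simp
  ultimately obtain \<rho> where \<rho>: "0 < \<rho>" "ball (of_real a) \<rho> \<subseteq> ?T"
    using open_contains_ball by metis
  show ?thesis
  proof (rule real_analytic_at_Re_holomorphic[OF \<rho>(1)])
    show "(\<lambda>z. G (F z)) holomorphic_on ball (of_real a) \<rho>"
      using \<rho>(2)
      by (intro holomorphic_on_compose_gen[unfolded o_def, OF holomorphic_on_subset[OF F(1)] G(1)]) auto
    show "g (u x) = Re (G (F (of_real x)))" if "x \<in> ball a \<rho>" for x
    proof -
      have "complex_of_real x \<in> ball (of_real a) \<rho>"
        using that by (metis dist_of_real mem_ball)
      then have "complex_of_real x \<in> ?T"
        using \<rho>(2) by blast
      then have "x \<in> ball a r" "F (of_real x) \<in> ball (of_real (u a)) s"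
        by (auto simp: dist_of_real)
      then show ?thesis
        using F(2) G(2) by (simp add: dist_of_real)
    qed
  qed
qed

text \<open>The complex derivative has real part \<open>h' x\<close>, hence is nonzero, and the
  extension of \<open>h\<close> has a local holomorphic inverse \<open>K\<close>. On the line
  \<open>K\<close> restricts to the real inverse.\<close>

lemma real_analytic_on_inv_into:
  fixes h :: "real \<Rightarrow> real"
  assumes J: "open J" and an: "real_analytic_on J h" and inj: "inj_on h J"
    and D: "\<And>x. x \<in> J \<Longrightarrow> (h has_real_derivative h' x) (at x)" "\<And>x. x \<in> J \<Longrightarrow> h' x \<noteq> 0"
  shows "real_analytic_on (h ` J) (inv_into J h)"
  unfolding real_analytic_on_def
proof
  fix y assume "y \<in> h ` J"
  then obtain x where x: "x \<in> J" and y: "y = h x"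
    by blast
  obtain F r where r: "0 < r" and F: "F holomorphic_on ball (of_real x) r"
    "\<And>t. t \<in> ball x r \<Longrightarrow> F (of_real t) = of_real (h t)"
    using real_analytic_at_holomorphic_extension[of h x] an x unfolding real_analytic_on_def by metis
  have "((\<lambda>t. Re (F (of_real t))) has_real_derivative Re (deriv F (of_real x))) (at x)"
    using r F(1) by (intro has_real_derivative_Re_of_real holomorphic_derivI) auto
  then have "(h has_real_derivative Re (deriv F (of_real x))) (at x)"
    by (rule has_field_derivative_transform_within_open[where S = "ball x r"]) (use r F(2) in auto)
  then have "Re (deriv F (of_real x)) = h' x"
    using D(1)[OF x] DERIV_unique by blast
  then have "deriv F (of_real x) \<noteq> 0"
    using D(2)[OF x] by auto
  then obtain \<rho> where \<rho>: "0 < \<rho>" "ball (complex_of_real x) \<rho> \<subseteq> ball (of_real x) r"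
    "inj_on F (ball (of_real x) \<rho>)"
    using has_complex_derivative_locally_injective[OF F(1) _ open_ball] r by (metis centre_in_ball)
  have F\<rho>: "F holomorphic_on ball (of_real x) \<rho>"
    using F(1) \<rho>(2) holomorphic_on_subset by blast
  obtain K where K: "K holomorphic_on F ` ball (of_real x) \<rho>"
    "\<And>z. z \<in> ball (of_real x) \<rho> \<Longrightarrow> K (F z) = z"
    using holomorphic_has_inverse[OF F\<rho> open_ball \<rho>(3)] by metis
  have "\<rho> \<le> r"
    using \<rho> by (simp add: ball_subset_ball_iff)
  let ?J = "J \<inter> ball x \<rho>"
  have "continuous_on ?J h"
    using D(1) by (intro continuous_at_imp_continuous_on ballI DERIV_isCont) auto
  \<comment> \<open>Invariance of domain ensures that points near \<open>y\<close> have their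
    preimage inside the disc on which \<open>K\<close> inverts \<open>F\<close>; injectivity on
    \<open>J\<close> makes it the preimage that \<open>inv_into\<close> selects.\<close>
  then have "open (h ` ?J)"
    using J inj by (intro invariance_of_domain) (auto intro: inj_on_subset)
  moreover have "y \<in> h ` ?J"
    using x y \<rho>(1) by simp
  ultimately obtain s where s: "0 < s" "ball y s \<subseteq> h ` ?J"
    using open_contains_ball by metis
  have "open (F ` ball (of_real x) \<rho>)"
    using open_mapping_thm3[OF F\<rho> open_ball \<rho>(3)] .
  moreover have "of_real y \<in> F ` ball (of_real x) \<rho>"
    using y F(2)[of x] r \<rho>(1) by (metis centre_in_ball image_eqI)
  ultimately obtain s' where s': "0 < s'" "ball (of_real y) s' \<subseteq> F ` ball (of_real x) \<rho>"
    using open_contains_ball by metis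
  show "real_analytic_at (inv_into J h) y"
  proof (rule real_analytic_at_Re_holomorphic)
    show "0 < min s s'"
      using s s' by simp
    show "K holomorphic_on ball (of_real y) (min s s')"
      using s'(2) by (intro holomorphic_on_subset[OF K(1)]) auto
    fix t assume "t \<in> ball y (min s s')"
    then have "t \<in> h ` ?J"
      using s(2) by auto
    then obtain w where w: "w \<in> J" "w \<in> ball x \<rho>" "t = h w"
      by blast
    then have "K (F (of_real w)) = of_real w"
      by (intro K) (simp add: dist_of_real)
    moreover have "F (of_real w) = of_real t"
      using F(2)[of w] w \<open>\<rho> \<le> r\<close> by simp
    ultimately show "inv_into J h t = Re (K (of_real t))"
      using inj w by (simp add: inv_into_f_f)
  qed
qed

text \<open>The holomorphic extension has a zero of finite order with cofactor \<open>G\<close>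
  nonzero at the centre. What needs an argument is that the real part of \<open>G\<close> is nonzero
  there as well.\<close>

lemma real_analytic_at_factor_zero:
  fixes \<phi> :: "real \<Rightarrow> real"
  assumes "real_analytic_at \<phi> b" and "\<phi> b = 0" and nz: "\<not> (\<forall>\<^sub>F t in nhds b. \<phi> t = 0)"
  obtains k \<psi> where "0 < k" "real_analytic_at \<psi> b" "\<psi> b \<noteq> 0"
    "\<forall>\<^sub>F t in nhds b. \<phi> t = (t - b) ^ k * \<psi> t"
proof -
  obtain F r where r: "0 < r" and F: "F holomorphic_on ball (of_real b) r"
    "\<And>x. x \<in> ball b r \<Longrightarrow> F (of_real x) = of_real (\<phi> x)"
    using real_analytic_at_holomorphic_extension[OF assms(1)] by blast
  have Fb: "F (of_real b) = 0"
    using F(2)[of b] r assms(2) by simp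
  have "\<not> F constant_on ball (of_real b) r"
  proof
    assume "F constant_on ball (of_real b) r"
    then have F0: "F z = 0" if "z \<in> ball (of_real b) r" for z
      using Fb r that unfolding constant_on_def by (metis centre_in_ball)
    have "\<phi> t = 0" if "t \<in> ball b r" for t
    proof -
      have "complex_of_real t \<in> ball (of_real b) r"
        using that by (metis dist_of_real mem_ball)
      then show ?thesis
        using F(2)[OF that] F0 by simp
    qed
    then have "\<forall>\<^sub>F t in nhds b. \<phi> t = 0"
      using eventually_nhds_ball[OF r, of b] by (rule eventually_mono[rotated])
    with nz show False ..
  qed
  then obtain G \<rho> k where k: "0 < k" and \<rho>: "0 < \<rho>" "ball (of_real b) \<rho> \<subseteq> ball (complex_of_real b) r"
    and G: "G holomorphic_on ball (of_real b) \<rho>"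
      "\<And>w. w \<in> ball (of_real b) \<rho> \<Longrightarrow> F w = (w - of_real b) ^ k * G w"
      "\<And>w. w \<in> ball (of_real b) \<rho> \<Longrightarrow> G w \<noteq> 0"
    using holomorphic_factor_zero_nonconstant[OF F(1) open_ball connected_ball _ Fb] r
    by (metis centre_in_ball)
  have eq: "of_real (\<phi> t) = of_real ((t - b) ^ k) * G (of_real t)" if t: "t \<in> ball b \<rho>" for t
  proof -
    have "complex_of_real t \<in> ball (of_real b) \<rho>"
      using t by (metis dist_of_real mem_ball)
    moreover have "t \<in> ball b r"
      using \<rho> t by (simp add: ball_subset_ball_iff)
    ultimately show ?thesis
      using F(2)[of t] G(2)[of "of_real t"] by (metis of_real_diff of_real_power)
  qed
  define \<psi> where "\<psi> t = Re (G (of_real t))" for t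
  have Re_eq: "\<phi> t = (t - b) ^ k * \<psi> t" if "t \<in> ball b \<rho>" for t
    using arg_cong[OF eq[OF that], of Re] unfolding \<psi>_def
    by (simp only: Re_complex_of_real Re_of_real_mult)
  \<comment> \<open>Away from \<open>b\<close> the cofactor is a quotient of real numbers; at
    \<open>b\<close> its imaginary part vanishes by continuity. So \<open>\<psi> b\<close> equals
    the value of \<open>G\<close>, which is nonzero.\<close>
  have Im_eq: "Im (G (of_real t)) = 0" if "t \<in> ball b \<rho>" "t \<noteq> b" for t
  proof -
    have "0 = (t - b) ^ k * Im (G (of_real t))"
      using arg_cong[OF eq[OF that(1)], of Im]
      by (simp only: Im_complex_of_real Im_of_real_mult)
    then show ?thesis
      using that by simp
  qed
  have "isCont G (of_real b)"
    using G(1) \<rho>(1) by (metis centre_in_ball continuous_on_interior holomorphic_on_imp_continuous_on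
        interior_ball)
  then have "((\<lambda>t. Im (G (of_real t))) \<longlongrightarrow> Im (G (of_real b))) (at b)"
    by (intro tendsto_Im isCont_tendsto_compose[of _ G] tendsto_of_real tendsto_ident_at)
  moreover have "\<forall>\<^sub>F t in at b. Im (G (of_real t)) = 0"
    using eventually_at_ball'[OF \<rho>(1), of b UNIV] by eventually_elim (use Im_eq in auto)
  then have "((\<lambda>t. Im (G (of_real t))) \<longlongrightarrow> 0) (at b)"
    by (rule tendsto_eventually)
  ultimately have "Im (G (of_real b)) = 0"
    by (intro tendsto_unique[of "at b"]) auto
  then have "\<psi> b \<noteq> 0"
    using G(3)[of "of_real b"] \<rho>(1) by (auto simp: \<psi>_def complex_eq_iff)
  moreover have "real_analytic_at \<psi> b"
    by (rule real_analytic_at_Re_holomorphic[OF \<rho>(1) G(1)]) (simp add: \<psi>_def)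
  moreover have "\<forall>\<^sub>F t in nhds b. \<phi> t = (t - b) ^ k * \<psi> t"
    using eventually_nhds_ball[OF \<rho>(1), of b] by eventually_elim (rule Re_eq)
  ultimately show thesis
    using k that by blast
qed

text \<open>Here \<open>g t = (t - b) * exp (\<integral>\<^sub>b\<^sup>t (\<psi> b / \<psi> s - 1) / (s - b) ds)\<close>, the coordinate in which the
  vector field \<open>(t - b) * \<psi> t\<close> becomes linear.\<close>

lemma linearizing_coordinate:
  fixes \<psi> :: "real \<Rightarrow> real"
  assumes "real_analytic_at \<psi> b" and nz: "\<psi> b \<noteq> 0"
  obtains g g' where "real_analytic_at g b" "g b = 0" "g' b = 1"
    "\<forall>\<^sub>F t in nhds b. (g has_real_derivative g' t) (at t) \<and> (t - b) * \<psi> t * g' t = \<psi> b * g t"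
proof -
  let ?b = "complex_of_real b"
  obtain P r where r: "0 < r" and P: "P holomorphic_on ball ?b r"
    "\<And>x. x \<in> ball b r \<Longrightarrow> P (of_real x) = of_real (\<psi> x)"
    using real_analytic_at_holomorphic_extension[OF assms(1)] by blast
  let ?T = "ball ?b r \<inter> P -` (- {0})"
  have "open ?T"
    using P(1) by (intro continuous_open_preimage holomorphic_on_imp_continuous_on) auto
  moreover have Pb: "P ?b = of_real (\<psi> b)"
    using r P(2)[of b] by simp
  then have "?b \<in> ?T"
    using r nz by simp
  ultimately obtain \<rho> where \<rho>: "0 < \<rho>" "ball ?b \<rho> \<subseteq> ?T"
    using open_contains_ball by metis
  \<comment> \<open>The equation to be solved says that G has logarithmic derivative A(z) / (z - b).
    Since A(b) = 1, this differs from 1 / (z - b) by the holomorphic function \<open>q\<close>, so G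
    is z - b times the exponential of a primitive of \<open>q\<close>.\<close>
  define A where "A z = of_real (\<psi> b) / P z" for z
  have A: "A holomorphic_on ball ?b \<rho>"
    unfolding A_def using \<rho>(2)
    by (intro holomorphic_on_divide holomorphic_on_const holomorphic_on_subset[OF P(1)]) auto
  have Ab: "A ?b = 1"
    using Pb nz by (simp add: A_def)
  \<comment> \<open>The value at the centre fills the removable singularity of (A - 1) / (z -
    b).\<close>
  define q where "q = (\<lambda>z. if z = ?b then deriv A ?b else (A z - A ?b) / (z - ?b))"
  have q: "q holomorphic_on ball ?b \<rho>"
    unfolding q_def by (rule pole_lemma_open[OF A open_ball])
  have qA: "1 + (z - ?b) * q z = A z" for z
    using Ab by (simp add: q_def)
  obtain Q where Q: "\<And>z. z \<in> ball ?b \<rho> \<Longrightarrow> (Q has_field_derivative q z) (at z)"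
    using holomorphic_convex_primitive'[OF convex_ball open_ball q]
    by (metis at_within_open open_ball)
  define E where "E z = exp (Q z - Q ?b)" for z
  define G where "G z = (z - ?b) * E z" for z
  have G: "(G has_field_derivative E z * A z) (at z)" if "z \<in> ball ?b \<rho>" for z
  proof -
    have "(G has_field_derivative E z + (z - ?b) * (E z * q z)) (at z)"
      unfolding G_def E_def by (auto intro!: derivative_eq_intros Q[OF that])
    moreover have "E z + (z - ?b) * (E z * q z) = E z * (1 + (z - ?b) * q z)"
      by (simp add: algebra_simps)
    ultimately show ?thesis
      by (simp add: qA)
  qed
  have lin: "(t - b) * \<psi> t * Re (E (of_real t) * A (of_real t)) = \<psi> b * Re (G (of_real t))"
    if t: "t \<in> ball b \<rho>" for t
  proof -
    have "complex_of_real t \<in> ball ?b \<rho>"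
      using t by (metis dist_of_real mem_ball)
    then have "of_real t \<in> ?T"
      using \<rho>(2) by blast
    then have "P (of_real t) \<noteq> 0" "P (of_real t) = of_real (\<psi> t)"
      using P(2) by (auto simp: dist_of_real)
    then have "of_real ((t - b) * \<psi> t) * (E (of_real t) * A (of_real t)) = of_real (\<psi> b) * G (of_real t)"
      by (simp add: A_def G_def)
    then show ?thesis
      using Re_of_real_mult by metis
  qed
  show thesis
  proof (rule that)
    have "G holomorphic_on ball ?b \<rho>"
      using G by (auto simp: holomorphic_on_open simp del: mem_ball)
    then show "real_analytic_at (\<lambda>t. Re (G (of_real t))) b"
      by (intro real_analytic_at_Re_holomorphic[OF \<rho>(1)]) auto
    show "Re (G (of_real b)) = 0"
      by (simp add: G_def)
    show "Re (E (of_real b) * A (of_real b)) = 1"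
      by (simp add: E_def Ab)
    show "\<forall>\<^sub>F t in nhds b. ((\<lambda>t. Re (G (of_real t))) has_real_derivative
        Re (E (of_real t) * A (of_real t))) (at t) \<and>
        (t - b) * \<psi> t * Re (E (of_real t) * A (of_real t)) = \<psi> b * Re (G (of_real t))"
      using eventually_nhds_ball[OF \<rho>(1), of b]
    proof eventually_elim
      case (elim t)
      then have "complex_of_real t \<in> ball ?b \<rho>"
        by (metis dist_of_real mem_ball)
      then show ?case
        using lin[OF elim] by (intro conjI has_real_derivative_Re_of_real G)
    qed
  qed
qed

section \<open>Webs separated by coordinatewise changes of variables\<close>

text \<open>The derivative is the real part of a holomorphic function, hence continuous and nonzero
  near \<open>a\<close>; injectivity is then the mean value theorem.\<close>

lemma real_analytic_at_local_diffeo: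
  fixes h :: "real \<Rightarrow> real"
  assumes "real_analytic_at h a" and "(h has_real_derivative d) (at a)" and "d \<noteq> 0"
  obtains \<delta> h' where "0 < \<delta>" "inj_on h (ball a \<delta>)"
    "\<And>s. s \<in> ball a \<delta> \<Longrightarrow> real_analytic_at h s"
    "\<And>s. s \<in> ball a \<delta> \<Longrightarrow> (h has_real_derivative h' s) (at s)"
    "\<And>s. s \<in> ball a \<delta> \<Longrightarrow> h' s \<noteq> 0"
proof -
  obtain F r where r: "0 < r" and F: "F holomorphic_on ball (of_real a) r"
    "\<And>x. x \<in> ball a r \<Longrightarrow> F (of_real x) = of_real (h x)"
    using real_analytic_at_holomorphic_extension[OF assms(1)] by blast
  define h' where "h' s = Re (deriv F (of_real s))" for s
  have h': "(h has_real_derivative h' s) (at s)" if s: "s \<in> ball a r" for s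
  proof -
    have "complex_of_real s \<in> ball (of_real a) r"
      using s by (metis dist_of_real mem_ball)
    then have "((\<lambda>t. Re (F (of_real t))) has_real_derivative h' s) (at s)"
      unfolding h'_def
      by (intro has_real_derivative_Re_of_real holomorphic_derivI[OF F(1) open_ball])
    then show ?thesis
      by (rule has_field_derivative_transform_within_open[where S = "ball a r"]) (use s F(2) in auto)
  qed
  have "h' a = d"
    using DERIV_unique[OF h' assms(2)] r by simp
  have "isCont (deriv F) (of_real a)"
    using holomorphic_deriv[OF F(1) open_ball] r
    by (metis centre_in_ball continuous_on_interior holomorphic_on_imp_continuous_on interior_ball)
  then have "(h' \<longlongrightarrow> h' a) (nhds a)"
    unfolding h'_def
    by (intro tendsto_Re isCont_tendsto_compose[of _ "deriv F"] tendsto_of_real filterlim_ident)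
  then have "\<forall>\<^sub>F s in nhds a. h' s \<noteq> 0"
    using \<open>h' a = d\<close> assms(3) by (intro tendsto_imp_eventually_ne) auto
  moreover have "\<forall>\<^sub>F s in nhds a. s \<in> ball a r"
    by (rule eventually_nhds_ball[OF r])
  ultimately have "\<forall>\<^sub>F s in nhds a. real_analytic_at h s \<and> s \<in> ball a r \<and> h' s \<noteq> 0"
    using real_analytic_at_imp_eventually[OF assms(1)] by eventually_elim blast
  then obtain \<delta> where \<delta>: "0 < \<delta>"
    "\<And>s. s \<in> ball a \<delta> \<Longrightarrow> real_analytic_at h s \<and> s \<in> ball a r \<and> h' s \<noteq> 0"
    unfolding eventually_nhds_metric by (auto simp: dist_commute)
  have "h x \<noteq> h y" if xy: "x < y" "x \<in> ball a \<delta>" "y \<in> ball a \<delta>" for x y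
  proof
    assume eq: "h x = h y"
    have in_ball: "s \<in> ball a \<delta>" if "x \<le> s" "s \<le> y" for s
      using that xy by (auto simp: dist_real_def)
    have "\<exists>z>x. z < y \<and> h y - h x = (y - x) * h' z"
      using xy(1) in_ball \<delta>(2) h' by (intro MVT2) auto
    then obtain z where "x < z" "z < y" "h y - h x = (y - x) * h' z"
      by blast
    then show False
      using eq xy(1) \<delta>(2)[OF in_ball[of z]] by simp
  qed
  then have "inj_on h (ball a \<delta>)"
    unfolding inj_on_def by (metis linorder_less_linear)
  then show thesis
    using that[of \<delta> h'] \<delta> h' by blast
qed

text \<open>Cubes are products of intervals, so functions of single coordinates can be treated
  factor by factor on them. The side is d / n because the norm is at most the sum of the n
  coordinates in absolute value.\<close>

lemma eventually_nhds_cube: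
  fixes P :: "real^'n \<Rightarrow> bool"
  assumes "\<forall>\<^sub>F x in nhds 0. P x"
  shows "\<exists>\<delta>>0. \<forall>x. (\<forall>i. x $ i \<in> ball 0 \<delta>) \<longrightarrow> P x"
proof -
  obtain d where d: "0 < d" "\<And>x. norm x < d \<Longrightarrow> P x"
    using assms unfolding eventually_nhds_metric by auto
  have "P x" if x: "\<And>i. x $ i \<in> ball 0 (d / CARD('n))" for x :: "real^'n"
  proof (rule d(2))
    have "norm x \<le> (\<Sum>i\<in>UNIV. \<bar>x $ i\<bar>)"
      by (rule norm_le_l1_cart)
    also have "\<dots> < (\<Sum>i\<in>(UNIV :: 'n set). d / CARD('n))"
      using x by (intro sum_strict_mono) (auto simp: dist_real_def)
    finally show "norm x < d" by simp
  qed
  with d(1) show ?thesis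
    by (intro exI[of _ "d / CARD('n)"]) auto
qed

lemma real_analytic_family_local_diffeo:
  fixes h :: "'i::finite \<Rightarrow> real \<Rightarrow> real"
  assumes h: "\<And>i. real_analytic_at (h i) a" "\<And>i. (h i has_real_derivative p i) (at a)" "\<And>i. p i \<noteq> 0"
    and "0 < \<epsilon>"
  obtains \<delta> h' where "0 < \<delta>" "\<delta> \<le> \<epsilon>" "\<And>i. inj_on (h i) (ball a \<delta>)"
    "\<And>i s. s \<in> ball a \<delta> \<Longrightarrow> real_analytic_at (h i) s"
    "\<And>i s. s \<in> ball a \<delta> \<Longrightarrow> (h i has_real_derivative h' i s) (at s)"
    "\<And>i s. s \<in> ball a \<delta> \<Longrightarrow> h' i s \<noteq> 0"
proof -
  have "\<forall>i. \<exists>\<delta> h'. 0 < \<delta> \<and> inj_on (h i) (ball a \<delta>) \<and> (\<forall>s\<in>ball a \<delta>. real_analytic_at (h i) s \<and>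
      (h i has_real_derivative h' s) (at s) \<and> h' s \<noteq> 0)"
    by (rule allI, rule real_analytic_at_local_diffeo[OF h]) blast
  then obtain d h' where d: "\<forall>i. 0 < d i \<and> inj_on (h i) (ball a (d i)) \<and> (\<forall>s\<in>ball a (d i).
      real_analytic_at (h i) s \<and> (h i has_real_derivative h' i s) (at s) \<and> h' i s \<noteq> 0)"
    unfolding choice_iff by blast
  define \<delta> where "\<delta> = min \<epsilon> (Min (range d))"
  have "\<delta> \<le> d i" for i
    by (simp add: \<delta>_def min.coboundedI2)
  then have sub: "ball a \<delta> \<subseteq> ball a (d i)" for i
    by (rule subset_ball)
  show thesis
  proof (rule that)
    show "0 < \<delta>" "\<delta> \<le> \<epsilon>"
      using d \<open>0 < \<epsilon>\<close> by (auto simp: \<delta>_def)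
    show "inj_on (h i) (ball a \<delta>)" for i
      using d by (intro inj_on_subset[OF _ sub[of i]]) simp
    fix i s assume "s \<in> ball a \<delta>"
    then have "s \<in> ball a (d i)"
      using sub by blast
    then show "real_analytic_at (h i) s" "(h i has_real_derivative h' i s) (at s)" "h' i s \<noteq> 0"
      using d by blast+
  qed
qed

lemma open_cube: "open {x :: real^'n. \<forall>i. x $ i \<in> ball 0 \<delta>}"
  by (rule open_vector_box) simp

section \<open>Maps acting on each coordinate separately\<close>

lemma real_analytic_at_coordinatewise:
  fixes u :: "'n::finite \<Rightarrow> real \<Rightarrow> real"
  assumes "\<And>i. real_analytic_at (u i) (a $ i)"
  shows "real_analytic_at (\<lambda>x::real^'n. \<chi> i. u i (x $ i)) a"
proof -
  have "real_analytic_at (\<lambda>x::real^'n. u i (x $ i)) a" for i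
    using real_analytic_at_coordinate[of "axis i 1" "u i" a] assms[of i]
    by (simp add: inner_axis axis_in_Basis_iff)
  then have "real_analytic_at (\<lambda>x::real^'n. \<Sum>i\<in>UNIV. u i (x $ i) *\<^sub>R axis i (1::real)) a"
    by (intro real_analytic_at_sum real_analytic_at_scaleR_left)
  moreover have "(\<Sum>i\<in>UNIV. u i (x $ i) *\<^sub>R axis i (1::real)) = (\<chi> i. u i (x $ i))" for x :: "real^'n"
    by (simp add: vec_eq_iff axis_def if_distrib cong: if_cong)
  ultimately show ?thesis by simp
qed

lemma real_analytic_at_inner_right:
  fixes \<Phi> :: "'a::euclidean_space \<Rightarrow> 'b::real_inner"
  assumes "real_analytic_at \<Phi> a"
  shows "real_analytic_at (\<lambda>x. c \<bullet> \<Phi> x) a"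
proof -
  obtain d r where "0 < r" and d: "\<And>x. x \<in> ball a r \<Longrightarrow>
      ((\<lambda>\<alpha>. (\<Prod>b\<in>Basis. ((x - a) \<bullet> b) ^ \<alpha> b) *\<^sub>R d \<alpha>) has_sum \<Phi> x) (Basis \<rightarrow>\<^sub>E UNIV)"
    using assms unfolding real_analytic_at_def by blast
  moreover have "((\<lambda>\<alpha>. (\<Prod>b\<in>Basis. ((x - a) \<bullet> b) ^ \<alpha> b) *\<^sub>R (c \<bullet> d \<alpha>)) has_sum c \<bullet> \<Phi> x)
      (Basis \<rightarrow>\<^sub>E UNIV)" if "x \<in> ball a r" for x
    using has_sum_bounded_linear[OF bounded_linear_inner_right d[OF that], of c] by simp
  ultimately show ?thesis
    unfolding real_analytic_at_def
    by (intro exI[of _ "\<lambda>\<alpha>. c \<bullet> d \<alpha>"] exI[of _ r]) blast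
qed

lemma has_derivative_inner_coordinatewise:
  fixes h :: "'n::finite \<Rightarrow> real \<Rightarrow> real"
  assumes "\<And>i. (h i has_real_derivative h' i (x $ i)) (at (x $ i))"
  shows "((\<lambda>x::real^'n. c \<bullet> (\<chi> i. h i (x $ i))) has_derivative
    (\<lambda>v. (\<chi> i. c $ i * h' i (x $ i)) \<bullet> v)) (at x)"
proof -
  have "((\<lambda>x::real^'n. h i (x $ i)) has_derivative (\<lambda>v. h' i (x $ i) * v $ i)) (at x)" for i
    using has_derivative_compose[OF bounded_linear.has_derivative[OF bounded_linear_vec_nth has_derivative_ident]
        assms[of i, unfolded has_field_derivative_def]] by simp
  then have "((\<lambda>x::real^'n. \<Sum>i\<in>UNIV. c $ i * h i (x $ i)) has_derivative
      (\<lambda>v. \<Sum>i\<in>UNIV. c $ i * (h' i (x $ i) * v $ i))) (at x)"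
    by (intro has_derivative_sum has_derivative_mult_right)
  then show ?thesis
    by (simp add: inner_vec_def mult.assoc)
qed

text \<open>Leaves depend only on the partition into level sets, so two first integrals can be
  compared by asking when values agree, with no function relating them.\<close>

lemma foliation_of_cong:
  assumes "\<And>x y. x \<in> V \<Longrightarrow> y \<in> V \<Longrightarrow> f x = f y \<longleftrightarrow> g x = g y"
  shows "foliation_of V f = foliation_of V g"
  unfolding foliation_of_def
proof (rule image_cong[OF refl])
  fix x assume "x \<in> V"
  then have "{y \<in> V. f y = f x} = {y \<in> V. g y = g x}"
    using assms by blast
  then show "connected_component_set {y \<in> V. f y = f x} x = connected_component_set {y \<in> V. g y = g x} x"
    by simp
qed

text \<open>The image is the product of the one-dimensional images, which reduces openness and the
  analyticity of the inverse to one variable.\<close>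

lemma analytic_coordinates_on_coordinatewise:
  fixes h h' :: "'n::finite \<Rightarrow> real \<Rightarrow> real"
  assumes J: "open J" and inj: "\<And>i. inj_on (h i) J"
    and an: "\<And>i s. s \<in> J \<Longrightarrow> real_analytic_at (h i) s"
    and D: "\<And>i s. s \<in> J \<Longrightarrow> (h i has_real_derivative h' i s) (at s)" "\<And>i s. s \<in> J \<Longrightarrow> h' i s \<noteq> 0"
  shows "analytic_coordinates_on {x. \<forall>i. x $ i \<in> J} (\<lambda>x. \<chi> i. h i (x $ i))"
    (is "analytic_coordinates_on ?V ?\<Phi>")
proof -
  have image: "?\<Phi> ` ?V = {y. \<forall>i. y $ i \<in> h i ` J}"
  proof (intro equalityI subsetI)
    fix y assume "y \<in> {y. \<forall>i. y $ i \<in> h i ` J}"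
    then have "\<forall>i. \<exists>s. s \<in> J \<and> y $ i = h i s"
      by blast
    then obtain x where "\<forall>i. x i \<in> J \<and> y $ i = h i (x i)"
      unfolding choice_iff by blast
    then show "y \<in> ?\<Phi> ` ?V"
      by (intro image_eqI[of _ _ "\<chi> i. x i"]) (auto simp: vec_eq_iff)
  qed auto
  have open_image: "open (h i ` J)" for i
  proof (rule invariance_of_domain[OF _ J inj])
    show "continuous_on J (h i)"
      using D(1) by (intro continuous_at_imp_continuous_on ballI) (rule DERIV_isCont)
  qed
  have "open (?\<Phi> ` ?V)"
    unfolding image by (rule open_vector_box) (simp add: open_image)
  moreover have "inj_on ?\<Phi> ?V"
  proof (rule inj_onI)
    fix x y assume "x \<in> ?V" "y \<in> ?V" "?\<Phi> x = ?\<Phi> y"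
    then have "x $ i = y $ i" for i
      using inj_onD[OF inj[of i], of "x $ i" "y $ i"] by (simp add: vec_eq_iff)
    then show "x = y"
      by (simp add: vec_eq_iff)
  qed
  moreover have "real_analytic_on ?V ?\<Phi>"
    unfolding real_analytic_on_def by (auto intro!: real_analytic_at_coordinatewise an)
  moreover have "real_analytic_on (?\<Phi> ` ?V) (inv_into ?V ?\<Phi>)"
    unfolding real_analytic_on_def
  proof
    fix y assume y: "y \<in> ?\<Phi> ` ?V"
    have "real_analytic_on (h i ` J) (inv_into J (h i))" for i
      using D an by (intro real_analytic_on_inv_into[OF J _ inj]) (auto simp: real_analytic_on_def)
    then have "real_analytic_at (inv_into J (h i)) (y $ i)" for i
      using y unfolding image real_analytic_on_def by blast
    then have "real_analytic_at (\<lambda>y. \<chi> i. inv_into J (h i) (y $ i)) y"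
      by (rule real_analytic_at_coordinatewise)
    \<comment> \<open>The componentwise inverse is \<open>inv_into\<close> of the product map only
      on the image; as the image is open, this suffices for analyticity at \<open>y\<close>.\<close>
    moreover have "\<forall>\<^sub>F z in nhds y. (\<chi> i. inv_into J (h i) (z $ i)) = inv_into ?V ?\<Phi> z"
      using eventually_nhds_in_open[OF \<open>open (?\<Phi> ` ?V)\<close> y]
    proof eventually_elim
      case (elim z)
      then obtain x where x: "x \<in> ?V" "z = ?\<Phi> x"
        by blast
      then have "inv_into ?V ?\<Phi> z = x"
        using inv_into_f_f[OF \<open>inj_on ?\<Phi> ?V\<close>, of x] by simp
      moreover have "inv_into J (h i) (z $ i) = x $ i" for i
        using x inj by (simp add: inv_into_f_f)
      ultimately show ?case
        by (simp add: vec_eq_iff)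
    qed
    ultimately show "real_analytic_at (inv_into ?V ?\<Phi>) y"
      by (rule real_analytic_at_cong)
  qed
  ultimately show ?thesis
    by (simp add: analytic_coordinates_on_def)
qed

text \<open>In the coordinates \<open>h i\<close> the foliation of x_i is given by the i-th
  coordinate. That of \<open>f\<close> is given by the sum of all coordinates: \<open>g\<close> is
  injective near \<open>f 0\<close>, so \<open>g \<circ> f\<close> has the level sets of
  \<open>f\<close>.\<close>

lemma parallelizable_coordinate_web:
  fixes f :: "real^'n \<Rightarrow> real" and h :: "'n \<Rightarrow> real \<Rightarrow> real"
  assumes "open U" "0 \<in> U" and f: "isCont f 0"
    and g: "real_analytic_at g (f 0)" "(g has_real_derivative d) (at (f 0))" "d \<noteq> 0"
    and h: "\<And>i. real_analytic_at (h i) 0" "\<And>i. (h i has_real_derivative p i) (at 0)" "\<And>i. p i \<noteq> 0"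
    and sep: "\<forall>\<^sub>F x in nhds 0. g (f x) = (\<Sum>i\<in>UNIV. h i (x $ i))"
  shows "parallelizable U (coordinate_web f)"
proof -
  obtain \<epsilon> where \<epsilon>: "0 < \<epsilon>" "inj_on g (ball (f 0) \<epsilon>)"
    using real_analytic_at_local_diffeo[OF g] by metis
  have "\<forall>\<^sub>F x in nhds 0. f x \<in> ball (f 0) \<epsilon>"
    using f \<epsilon>(1) by (intro topological_tendstoD) (auto simp: continuous_at tendsto_at_iff_tendsto_nhds)
  moreover have "\<forall>\<^sub>F x in nhds 0. x \<in> U"
    using assms(1,2) by (rule eventually_nhds_in_open)
  ultimately have "\<forall>\<^sub>F x in nhds 0. x \<in> U \<and> f x \<in> ball (f 0) \<epsilon> \<and> g (f x) = (\<Sum>i\<in>UNIV. h i (x $ i))"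
    using sep by eventually_elim blast
  from eventually_nhds_cube[OF this] obtain \<delta>1 where \<delta>1: "0 < \<delta>1" "\<forall>x. (\<forall>i. x $ i \<in> ball 0 \<delta>1) \<longrightarrow>
      x \<in> U \<and> f x \<in> ball (f 0) \<epsilon> \<and> g (f x) = (\<Sum>i\<in>UNIV. h i (x $ i))"
    by (elim exE conjE)
  obtain \<delta> h' where \<delta>: "0 < \<delta>" "\<delta> \<le> \<delta>1" and inj: "\<And>i. inj_on (h i) (ball 0 \<delta>)"
    and hJ: "\<And>i s. s \<in> ball 0 \<delta> \<Longrightarrow> real_analytic_at (h i) s"
    "\<And>i s. s \<in> ball 0 \<delta> \<Longrightarrow> (h i has_real_derivative h' i s) (at s)"
    "\<And>i s. s \<in> ball 0 \<delta> \<Longrightarrow> h' i s \<noteq> 0"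
    using real_analytic_family_local_diffeo[of h 0 p, OF h \<delta>1(1)] by metis
  let ?J = "ball (0::real) \<delta>"
  let ?V = "{x :: real^'n. \<forall>i. x $ i \<in> ?J}"
  let ?\<Phi> = "\<lambda>x :: real^'n. (\<chi> i. h i (x $ i)) :: real^'n"
  have V: "x \<in> U" "f x \<in> ball (f 0) \<epsilon>" "g (f x) = (\<Sum>i\<in>UNIV. h i (x $ i))" if "x \<in> ?V" for x
  proof -
    have "\<forall>i. x $ i \<in> ball 0 \<delta>1"
      using subset_ball[OF \<delta>(2), of 0] that by blast
    then show "x \<in> U" "f x \<in> ball (f 0) \<epsilon>" "g (f x) = (\<Sum>i\<in>UNIV. h i (x $ i))"
      using \<delta>1(2) by simp_all
  qed
  have sub: "submersion_on ?V (\<lambda>x. c \<bullet> ?\<Phi> x)" if "c \<noteq> 0" for c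
    unfolding submersion_on_def real_analytic_on_def
  proof (intro conjI ballI)
    fix x assume x: "x \<in> ?V"
    then show "real_analytic_at (\<lambda>x. c \<bullet> ?\<Phi> x) x"
      by (intro real_analytic_at_inner_right real_analytic_at_coordinatewise hJ) simp
    have "gradient (\<lambda>x. c \<bullet> ?\<Phi> x) x = (\<chi> i. c $ i * h' i (x $ i))"
      using x by (intro gradient_eqI has_derivative_inner_coordinatewise hJ) simp
    then show "gradient (\<lambda>x. c \<bullet> ?\<Phi> x) x \<noteq> 0"
      using that x hJ(3) by (auto simp: vec_eq_iff)
  qed
  \<comment> \<open>The linear forms are the vector of ones for \<open>f\<close> and the i-th unit
    vector for x_i. Both are nonzero, which is all that \<open>sub\<close> requires.\<close>
  have levels: "\<exists>c. c \<noteq> 0 \<and> (\<forall>x\<in>?V. \<forall>y\<in>?V. coordinate_web f k x = coordinate_web f k y \<longleftrightarrow> c \<bullet> ?\<Phi> x = c \<bullet> ?\<Phi> y)"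
    for k
  proof (cases k)
    case None
    have "f x = f y \<longleftrightarrow> (\<chi> i. 1) \<bullet> ?\<Phi> x = (\<chi> i. 1) \<bullet> ?\<Phi> y" if "x \<in> ?V" "y \<in> ?V" for x y
    proof -
      have "f x = f y \<longleftrightarrow> g (f x) = g (f y)"
        using \<epsilon>(2) V(2)[OF that(1)] V(2)[OF that(2)] by (auto dest: inj_onD)
      then show ?thesis
        using V(3)[OF that(1)] V(3)[OF that(2)] by (simp add: inner_vec_def)
    qed
    moreover have "(\<chi> i. 1) \<noteq> (0 :: real^'n)"
      by (simp add: vec_eq_iff)
    ultimately show ?thesis
      unfolding coordinate_web_def None option.case by blast
  next
    case (Some i)
    have "x $ i = y $ i \<longleftrightarrow> axis i 1 \<bullet> ?\<Phi> x = axis i 1 \<bullet> ?\<Phi> y" if "x \<in> ?V" "y \<in> ?V" for x y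
      using that inj_on_eq_iff[OF inj[of i], of "x $ i" "y $ i"] by (simp add: inner_axis')
    moreover have "axis i 1 \<noteq> (0 :: real^'n)"
      by simp
    ultimately show ?thesis
      unfolding coordinate_web_def Some option.case by blast
  qed
  have "\<exists>l. linear l \<and> first_integral_on ?V (foliation_of ?V (coordinate_web f k)) (l \<circ> ?\<Phi>)" for k
  proof -
    obtain c where "c \<noteq> 0"
      "\<And>x y. x \<in> ?V \<Longrightarrow> y \<in> ?V \<Longrightarrow> coordinate_web f k x = coordinate_web f k y \<longleftrightarrow> c \<bullet> ?\<Phi> x = c \<bullet> ?\<Phi> y"
      using levels[of k] by blast
    then have "first_integral_on ?V (foliation_of ?V (coordinate_web f k)) (\<lambda>x. c \<bullet> ?\<Phi> x)"
      unfolding first_integral_on_def by (intro conjI sub foliation_of_cong)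
    moreover have "linear (\<lambda>y. c \<bullet> y)"
      by (simp add: bounded_linear.linear bounded_linear_inner_right)
    ultimately show ?thesis
      unfolding o_def by blast
  qed
  moreover have "analytic_coordinates_on ?V ?\<Phi>"
    using hJ by (intro analytic_coordinates_on_coordinatewise[OF open_ball inj]) auto
  moreover have "open ?V"
    by (rule open_cube)
  moreover have "?V \<subseteq> U" "0 \<in> ?V"
    using V(1) \<delta>(1) by auto
  ultimately show ?thesis
    unfolding parallelizable_def by blast
qed

section \<open>Linearization of the infinitesimal isomorphism\<close>

lemma axis_zero: "axis i 0 = (0 :: real^'n)"
  by (simp add: vec_eq_iff axis_def)

lemma real_analytic_at_axis:
  fixes f :: "real^'n \<Rightarrow> real"
  assumes "real_analytic_at f 0"
  shows "real_analytic_at (\<lambda>s. f (axis i s)) 0"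
proof -
  have "real_analytic_at (\<lambda>s. f (0 + s *\<^sub>R axis i 1)) 0"
    using assms by (intro real_analytic_at_along_axis) (simp_all add: axis_in_Basis_iff)
  moreover have "0 + s *\<^sub>R axis i 1 = (axis i s :: real^'n)" for s
    by (simp add: vec_eq_iff axis_def)
  ultimately show ?thesis
    by simp
qed

lemma DERIV_along_curve:
  fixes f :: "real^'n \<Rightarrow> real" and c :: "real \<Rightarrow> real^'n"
  assumes "f differentiable at (c t)" and c: "\<And>i. ((\<lambda>t. c t $ i) has_real_derivative c' i) (at t)"
  shows "((\<lambda>t. f (c t)) has_real_derivative (\<Sum>i\<in>UNIV. c' i * gradient f (c t) $ i)) (at t)"
proof -
  have "(c has_derivative (\<lambda>s. \<chi> i. c' i * s)) (at t)"
    using c by (subst has_derivative_componentwise_within)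
      (auto simp: Basis_vec_def inner_axis has_field_derivative_def)
  from has_derivative_compose[OF this has_derivative_gradient[OF assms(1)]]
  have "((\<lambda>t. f (c t)) has_derivative (\<lambda>s. gradient f (c t) \<bullet> (\<chi> i. c' i * s))) (at t)" .
  moreover have "(\<lambda>s. gradient f (c t) \<bullet> (\<chi> i. c' i * s)) = (*) (\<Sum>i\<in>UNIV. c' i * gradient f (c t) $ i)"
    by (simp add: fun_eq_iff inner_vec_def sum_distrib_left mult_ac)
  ultimately show ?thesis
    by (simp add: has_field_derivative_def)
qed

lemma DERIV_along_axis:
  fixes f :: "real^'n \<Rightarrow> real"
  assumes "f differentiable at (axis i s)"
  shows "((\<lambda>s. f (axis i s)) has_real_derivative gradient f (axis i s) $ i) (at s)"
proof -
  have "((\<lambda>s. axis i s $ j) has_real_derivative (if j = i then 1 else 0)) (at s)" for j :: 'n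
    by (cases "j = i") (auto simp: axis_def)
  from DERIV_along_curve[OF assms this] show ?thesis
    by (simp add: if_distrib[of "\<lambda>a. a * _"] cong: if_cong)
qed

lemma gradient_coordinate: "gradient (\<lambda>x::real^'n. x $ i) x = axis i 1"
  by (rule gradient_eqI)
    (simp add: inner_axis' bounded_linear_imp_has_derivative bounded_linear_vec_nth)

text \<open>If the i-th partial derivative were 0, the gradient of \<open>f\<close> would be a
  combination of the other n - 1 axis vectors, against transversality of \<open>f\<close> with the
  coordinates other than x_i. The coefficients \<open>c\<close> write out this relation.\<close>

lemma coordinate_web_partial_nonzero:
  fixes f :: "real^'n \<Rightarrow> real"
  assumes "web_on U (coordinate_web f)" and x: "x \<in> U"
  shows "gradient f x $ i \<noteq> 0"
proof
  assume zero: "gradient f x $ i = 0"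
  let ?K = "insert None (Some ` (UNIV - {i}))"
  define c where "c k = (case k of None \<Rightarrow> 1 | Some j \<Rightarrow> - gradient f x $ j)" for k
  have "card ?K = CARD('n)"
    by (simp add: card_image card_Diff_singleton)
  moreover have "(\<Sum>k\<in>?K. c k *\<^sub>R gradient (coordinate_web f k) x) = 0"
  proof -
    have "(\<Sum>k\<in>?K. c k *\<^sub>R gradient (coordinate_web f k) x)
        = gradient f x - (\<Sum>j\<in>UNIV - {i}. gradient f x $ j *\<^sub>R axis j 1)"
      by (simp add: sum.reindex c_def coordinate_web_def gradient_coordinate sum_negf)
    also have "(\<Sum>j\<in>UNIV - {i}. gradient f x $ j *\<^sub>R axis j 1) = (\<Sum>j\<in>UNIV. gradient f x $ j *\<^sub>R axis j 1)"
      using zero by (intro sum.mono_neutral_left) auto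
    also have "\<dots> = gradient f x"
      by (metis basis_expansion scalar_mult_eq_scaleR)
    finally show ?thesis by simp
  qed
  ultimately have "c None = 0"
    using assms unfolding web_on_def by blast
  then show False
    by (simp add: c_def)
qed

text \<open>The limit of phi(f(t v)) / t^k is computed twice: from the growth of \<open>f\<close>
  along \<open>v\<close>, and from the equation for X with the leading terms of the
  \<open>\<xi> i\<close> found on the axes.\<close>

lemma vanishing_order_one:
  fixes f :: "real^'n \<Rightarrow> real"
  assumes U: "open U" "0 \<in> U" and f: "real_analytic_on U f"
    and p: "\<And>i. gradient f 0 $ i \<noteq> 0"
    and E: "\<And>x. x \<in> U \<Longrightarrow> (\<Sum>i\<in>UNIV. \<xi> i (x $ i) * gradient f x $ i) = \<phi> (f x)"
    and \<xi>: "\<And>i s. axis i s \<in> U \<Longrightarrow> \<xi> i s * gradient f (axis i s) $ i = \<phi> (f (axis i s))"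
    and \<phi>: "\<forall>\<^sub>F t in nhds (f 0). \<phi> t = (t - f 0) ^ k * \<psi> t"
    and \<psi>: "isCont \<psi> (f 0)" "\<psi> (f 0) \<noteq> 0"
    and n: "2 \<le> CARD('n)"
  shows "k = 1"
proof -
  let ?p = "gradient f 0"
  have "f differentiable at 0"
    using f U(2) by (intro real_analytic_at_imp_differentiable) (simp add: real_analytic_on_def)
  have path: "filterlim (\<lambda>t. t *\<^sub>R w) (nhds 0) (at 0)" for w :: "real^'n"
    using tendsto_scaleR[OF tendsto_ident_at[of 0 UNIV] tendsto_const[of w]] by simp
  have in_U: "\<forall>\<^sub>F t in at 0. t *\<^sub>R w \<in> U" for w :: "real^'n"
    using eventually_compose_filterlim[OF eventually_nhds_in_open[OF U] path] .
  have lim: "((\<lambda>t. \<phi> (f (t *\<^sub>R w)) / t ^ k) \<longlongrightarrow> (?p \<bullet> w) ^ k * \<psi> (f 0)) (at 0)" for w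
  proof -
    have "((\<lambda>t. f (t *\<^sub>R w)) has_real_derivative (\<Sum>i\<in>UNIV. w $ i * gradient f (0 *\<^sub>R w) $ i)) (at 0)"
      using \<open>f differentiable at 0\<close>
      by (intro DERIV_along_curve) (auto intro!: derivative_eq_intros)
    then have d: "((\<lambda>t. f (t *\<^sub>R w)) has_real_derivative (?p \<bullet> w)) (at 0)"
      by (simp add: inner_vec_def mult.commute)
    then have quot: "((\<lambda>t. (f (t *\<^sub>R w) - f 0) / t) \<longlongrightarrow> ?p \<bullet> w) (at 0)"
      by (simp add: DERIV_def)
    have cont: "((\<lambda>t. f (t *\<^sub>R w)) \<longlongrightarrow> f 0) (at 0)"
      using DERIV_isCont[OF d] by (simp add: isCont_def)
    have "((\<lambda>t. ((f (t *\<^sub>R w) - f 0) / t) ^ k * \<psi> (f (t *\<^sub>R w))) \<longlongrightarrow> (?p \<bullet> w) ^ k * \<psi> (f 0)) (at 0)"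
      by (intro tendsto_mult tendsto_power quot isCont_tendsto_compose[OF \<psi>(1) cont])
    moreover have "\<forall>\<^sub>F t in at 0. ((f (t *\<^sub>R w) - f 0) / t) ^ k * \<psi> (f (t *\<^sub>R w)) = \<phi> (f (t *\<^sub>R w)) / t ^ k"
      using eventually_compose_filterlim[OF \<phi> cont]
      by eventually_elim (simp add: power_divide)
    ultimately show ?thesis
      by (rule Lim_transform_eventually)
  qed
  have grad: "((\<lambda>t. gradient f (t *\<^sub>R w) $ i) \<longlongrightarrow> ?p $ i) (at 0)" for w i
    by (rule filterlim_compose[OF gradient_tendsto[OF U f] path])
  \<comment> \<open>The axis vector is scaled so that \<open>f\<close> has derivative 1 along it;
    the limit of phi(f) / t^k is then just \<open>\<psi> (f 0)\<close>.\<close>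
  have \<xi>_lim: "((\<lambda>t. \<xi> i (t / ?p $ i) / t ^ k) \<longlongrightarrow> \<psi> (f 0) / ?p $ i) (at 0)" for i
  proof -
    let ?w = "axis i (1 / ?p $ i) :: real^'n"
    have "?p \<bullet> ?w = 1"
      using p by (simp add: inner_axis)
    then have "((\<lambda>t. \<phi> (f (t *\<^sub>R ?w)) / t ^ k / gradient f (t *\<^sub>R ?w) $ i) \<longlongrightarrow> \<psi> (f 0) / ?p $ i) (at 0)"
      using tendsto_divide[OF lim grad p, of ?w ?w i] by simp
    moreover have "\<forall>\<^sub>F t in at 0. gradient f (t *\<^sub>R ?w) $ i \<noteq> 0"
      by (rule tendsto_imp_eventually_ne[OF grad p])
    with in_U[of ?w] have "\<forall>\<^sub>F t in at 0. \<phi> (f (t *\<^sub>R ?w)) / t ^ k / gradient f (t *\<^sub>R ?w) $ i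
        = \<xi> i (t / ?p $ i) / t ^ k"
    proof eventually_elim
      case (elim t)
      have "t *\<^sub>R ?w = axis i (t / ?p $ i)"
        by (simp add: vec_eq_iff axis_def)
      then show ?case
        using elim \<xi>[of i "t / ?p $ i"] by (simp flip: \<xi> add: field_simps)
    qed
    ultimately show ?thesis
      by (rule Lim_transform_eventually)
  qed
  \<comment> \<open>The i-th coordinate of t v is the argument for which \<open>\<xi>_lim\<close>
    gives the leading term of \<open>\<xi> i\<close>.\<close>
  define v :: "real^'n" where "v = (\<chi> i. 1 / ?p $ i)"
  have "((\<lambda>t. \<Sum>i\<in>UNIV. (\<xi> i (t / ?p $ i) / t ^ k) * gradient f (t *\<^sub>R v) $ i) \<longlongrightarrow>
      (\<Sum>i\<in>(UNIV::'n set). \<psi> (f 0) / ?p $ i * ?p $ i)) (at 0)"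
    by (intro tendsto_sum tendsto_mult \<xi>_lim grad)
  moreover have "\<forall>\<^sub>F t in at 0. (\<Sum>i\<in>UNIV. (\<xi> i (t / ?p $ i) / t ^ k) * gradient f (t *\<^sub>R v) $ i)
      = \<phi> (f (t *\<^sub>R v)) / t ^ k"
    using in_U[of v]
  proof eventually_elim
    case (elim t)
    then show ?case
      using E[of "t *\<^sub>R v"] by (simp add: v_def sum_divide_distrib[symmetric])
  qed
  ultimately have "((\<lambda>t. \<phi> (f (t *\<^sub>R v)) / t ^ k) \<longlongrightarrow>
      (\<Sum>i\<in>(UNIV::'n set). \<psi> (f 0) / ?p $ i * ?p $ i)) (at 0)"
    by (rule Lim_transform_eventually)
  then have "(\<Sum>i\<in>(UNIV::'n set). \<psi> (f 0) / ?p $ i * ?p $ i) = (?p \<bullet> v) ^ k * \<psi> (f 0)"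
    using tendsto_unique[OF _ _ lim] by simp
  moreover have "?p \<bullet> v = CARD('n)"
    using p by (simp add: v_def inner_vec_def)
  ultimately have "real CARD('n) ^ k = real CARD('n) ^ 1"
    using p \<psi>(2) by simp
  then show ?thesis
    using n power_inject_exp[of "real CARD('n)" k 1] by simp
qed

text \<open>A point is joined to the origin by the curve that is a ray in the coordinates h_i. Its
  velocity is X / (\<mu> t), so G = g o f along it solves G' = G / t and G(t) / t is constant. The
  value at t = 1 is g(f(x)); the limit at 0 is G'(0), the sum of the coordinates.\<close>

lemma linearized_first_integral_separates:
  fixes f :: "real^'n \<Rightarrow> real"
  assumes U: "open U" "0 \<in> U" and f: "real_analytic_on U f"
    and p: "\<And>i. gradient f 0 $ i \<noteq> 0"
    and E: "\<And>x. x \<in> U \<Longrightarrow> (\<Sum>i\<in>UNIV. \<xi> i (x $ i) * gradient f x $ i) = \<phi> (f x)"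
    and \<xi>: "\<And>i s. axis i s \<in> U \<Longrightarrow> \<xi> i s * gradient f (axis i s) $ i = \<phi> (f (axis i s))"
    and g: "real_analytic_at g (f 0)" "g (f 0) = 0" "g' (f 0) = 1"
    and lin: "\<forall>\<^sub>F t in nhds (f 0). (g has_real_derivative g' t) (at t) \<and> \<phi> t * g' t = \<mu> * g t"
    and \<mu>: "\<mu> \<noteq> 0"
  shows "\<forall>\<^sub>F x in nhds 0. g (f x) = (\<Sum>i\<in>UNIV. g (f (axis i (x $ i))))"
proof -
  let ?p = "gradient f 0"
  have diff: "f differentiable at x" if "x \<in> U" for x
    using f that by (intro real_analytic_at_imp_differentiable) (simp add: real_analytic_on_def)
  have "(f \<longlongrightarrow> f 0) (nhds 0)"
    using differentiable_imp_continuous_within[OF diff[OF U(2)]]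
    by (simp add: continuous_within tendsto_at_iff_tendsto_nhds)
  from eventually_compose_filterlim[OF lin this] eventually_nhds_in_open[OF U]
  have "\<forall>\<^sub>F x in nhds 0. x \<in> U \<and> (g has_real_derivative g' (f x)) (at (f x)) \<and> \<phi> (f x) * g' (f x) = \<mu> * g (f x)"
    by eventually_elim blast
  from eventually_nhds_cube[OF this] obtain \<epsilon> where "0 < \<epsilon>" and cube: "\<forall>x. (\<forall>i. x $ i \<in> ball 0 \<epsilon>) \<longrightarrow>
      x \<in> U \<and> (g has_real_derivative g' (f x)) (at (f x)) \<and> \<phi> (f x) * g' (f x) = \<mu> * g (f x)"
    by (elim exE conjE)
  define h where "h i s = g (f (axis i s))" for i s
  have axis_cube: "\<forall>j. (axis i s :: real^'n) $ j \<in> ball 0 \<epsilon>" if "s \<in> ball 0 \<epsilon>" for i s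
    using that \<open>0 < \<epsilon>\<close> by (simp add: axis_def)
  have h_deriv: "(h i has_real_derivative g' (f (axis i s)) * gradient f (axis i s) $ i) (at s)"
    if "s \<in> ball 0 \<epsilon>" for i s
  proof -
    have "axis i s \<in> U" "(g has_real_derivative g' (f (axis i s))) (at (f (axis i s)))"
      using cube axis_cube[OF that, of i] by blast+
    then show ?thesis
      unfolding h_def by (intro DERIV_chain2[of g] DERIV_along_axis diff)
  qed
  have h_an: "real_analytic_at (h i) 0" for i
  proof -
    have "real_analytic_at (\<lambda>s. f (axis i s)) 0"
      using f U(2) by (intro real_analytic_at_axis) (simp add: real_analytic_on_def)
    then show ?thesis
      unfolding h_def by (rule real_analytic_at_compose) (simp add: axis_zero g(1))
  qed
  have h_deriv0: "(h i has_real_derivative ?p $ i) (at 0)" for i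
    using h_deriv[of 0 i] \<open>0 < \<epsilon>\<close> by (simp add: axis_zero g(3))
  obtain \<delta> h' where \<delta>: "0 < \<delta>" "\<delta> \<le> \<epsilon>" and inj: "\<And>i. inj_on (h i) (ball 0 \<delta>)"
    and "\<And>i s. s \<in> ball 0 \<delta> \<Longrightarrow> real_analytic_at (h i) s"
    and h': "\<And>i s. s \<in> ball 0 \<delta> \<Longrightarrow> (h i has_real_derivative h' i s) (at s)"
      "\<And>i s. s \<in> ball 0 \<delta> \<Longrightarrow> h' i s \<noteq> 0"
    by (rule real_analytic_family_local_diffeo[of h 0 "\<lambda>i. ?p $ i", OF h_an h_deriv0 p \<open>0 < \<epsilon>\<close>]) blast
  let ?J = "ball (0::real) \<delta>"
  have J: "?J \<subseteq> ball 0 \<epsilon>"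
    using \<delta>(2) by (rule subset_ball)
  have h'_0: "h' i 0 = ?p $ i" for i
    using DERIV_unique[OF h'(1) h_deriv0] \<delta>(1) by simp
  \<comment> \<open>The axis equation multiplied by g': each h_i linearizes its own component of X
    with the same eigenvalue \<open>\<mu>\<close>.\<close>
  have \<xi>h: "\<xi> i s * h' i s = \<mu> * h i s" if "s \<in> ?J" for i s
  proof -
    have s: "s \<in> ball 0 \<epsilon>"
      using J that by blast
    have "axis i s \<in> U" "\<phi> (f (axis i s)) * g' (f (axis i s)) = \<mu> * g (f (axis i s))"
      using cube axis_cube[OF s, of i] by blast+
    moreover have "h' i s = g' (f (axis i s)) * gradient f (axis i s) $ i"
      by (rule DERIV_unique[OF h'(1)[OF that] h_deriv[OF s]])
    ultimately show ?thesis
      using \<xi>[of i s] by (metis h_def mult.assoc mult.commute)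
  qed
  have h_cont: "continuous_on ?J (h i)" for i
    using h'(1) by (intro continuous_at_imp_continuous_on ballI) (rule DERIV_isCont)
  have h0: "h i 0 = 0" for i
    by (simp add: h_def axis_zero g(2))
  have main: "g (f x) = (\<Sum>i\<in>UNIV. h i (x $ i))" if x: "\<And>i. x $ i \<in> ?J" for x :: "real^'n"
  proof -
    define y where "y i = h i (x $ i)" for i
    define c :: "real \<Rightarrow> real^'n" where "c t = (\<chi> i. inv_into ?J (h i) (t * y i))" for t
    \<comment> \<open>The image of the interval under \<open>h i\<close> is connected and contains 0
      and \<open>y i\<close>, hence the whole segment between them. So the curve stays in the cube
      up to and including t = 1.\<close>
    have ty: "t * y i \<in> h i ` ?J" if t: "0 \<le> t" "t \<le> 1" for t i
    proof -
      have conn: "connected (h i ` ?J)"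
        by (intro connected_continuous_image h_cont connected_ball)
      have ends: "0 \<in> h i ` ?J" "y i \<in> h i ` ?J"
        using h0[of i] \<delta>(1) x[of i] by (auto simp: y_def image_iff simp del: mem_ball intro: bexI[of _ 0])
      show ?thesis
      proof (cases "0 \<le> y i")
        case True
        then show ?thesis
          using t by (intro connectedD_interval[OF conn ends]) (auto simp: mult_left_le_one_le)
      next
        case False
        then have "y i \<le> t * y i" "t * y i \<le> 0"
          using t by (auto simp: mult_le_0_iff mult_le_cancel_right1)
        then show ?thesis
          by (rule connectedD_interval[OF conn ends(2,1)])
      qed
    qed
    have cJ: "c t $ i \<in> ?J" and hc: "h i (c t $ i) = t * y i" if t: "0 \<le> t" "t \<le> 1" for t i
      using inv_into_into[OF ty[OF t, of i]] f_inv_into_f[OF ty[OF t, of i]] by (simp_all add: c_def)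
    have c1: "c 1 = x"
      using x inv_into_f_f[OF inj] by (simp add: c_def y_def vec_eq_iff)
    have c0: "c 0 = 0"
      using inv_into_f_f[OF inj, of 0] \<delta>(1) by (simp add: c_def h0 vec_eq_iff)
    have c_cube: "c t \<in> U" "(g has_real_derivative g' (f (c t))) (at (f (c t)))"
      "\<phi> (f (c t)) * g' (f (c t)) = \<mu> * g (f (c t))" if t: "0 \<le> t" "t \<le> 1" for t
    proof -
      have "\<forall>i. c t $ i \<in> ball 0 \<epsilon>"
        using cJ[OF t] J by blast
      then show "c t \<in> U" "(g has_real_derivative g' (f (c t))) (at (f (c t)))"
        "\<phi> (f (c t)) * g' (f (c t)) = \<mu> * g (f (c t))"
        using cube by blast+
    qed
    have c_deriv: "((\<lambda>t. c t $ i) has_real_derivative y i / h' i (c t $ i)) (at t)"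
      if t: "0 \<le> t" "t \<le> 1" for t i
    proof -
      have "(inv_into ?J (h i) has_real_derivative inverse (h' i (c t $ i))) (at (h i (c t $ i)))"
        using h' cJ[OF t, of i] inj
        by (intro has_field_derivative_inverse_strong[where S = ?J] h_cont)
          (auto simp: inv_into_f_f simp del: mem_ball)
      then have "(inv_into ?J (h i) has_real_derivative inverse (h' i (c t $ i))) (at (t * y i))"
        by (simp add: hc[OF t])
      moreover have "((\<lambda>t. t * y i) has_real_derivative y i) (at t)"
        by (auto intro!: derivative_eq_intros)
      ultimately have "((\<lambda>t. inv_into ?J (h i) (t * y i)) has_real_derivative
          inverse (h' i (c t $ i)) * y i) (at t)"
        by (rule DERIV_chain2)
      then show ?thesis
        by (simp add: c_def divide_inverse mult.commute)
    qed
    define G where "G t = g (f (c t))" for t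
    have G: "(G has_real_derivative
        g' (f (c t)) * (\<Sum>i\<in>UNIV. y i / h' i (c t $ i) * gradient f (c t) $ i)) (at t)"
      if t: "0 \<le> t" "t \<le> 1" for t
      unfolding G_def
      by (rule DERIV_chain2[OF c_cube(2)[OF t] DERIV_along_curve[OF diff[OF c_cube(1)[OF t]] c_deriv[OF t]]])
    \<comment> \<open>By \<open>\<xi>h\<close> the velocity of the curve is X / (\<mu> t), so the
      chain rule sum is phi(f) / (\<mu> t) by \<open>E\<close>, and the linearization of phi by
      \<open>g\<close> turns this into G / t.\<close>
    have G': "(G has_real_derivative G t / t) (at t)" if t: "0 < t" "t \<le> 1" for t
    proof -
      have "y i / h' i (c t $ i) = \<xi> i (c t $ i) / (\<mu> * t)" for i
      proof -
        have "\<xi> i (c t $ i) * h' i (c t $ i) = \<mu> * (t * y i)"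
          using \<xi>h[OF cJ[of t i], of i] hc[of t i] t by simp
        then show ?thesis
          using h'(2)[OF cJ[of t i], of i] t \<mu> by (simp add: field_simps)
      qed
      then have "(\<Sum>i\<in>UNIV. y i / h' i (c t $ i) * gradient f (c t) $ i) = \<phi> (f (c t)) / (\<mu> * t)"
        using E[OF c_cube(1), of t] t by (simp add: sum_divide_distrib[symmetric])
      then have "g' (f (c t)) * (\<Sum>i\<in>UNIV. y i / h' i (c t $ i) * gradient f (c t) $ i)
          = (\<phi> (f (c t)) * g' (f (c t))) / (\<mu> * t)"
        by (simp only: times_divide_eq_right mult.commute)
      also have "\<dots> = G t / t"
        using c_cube(3)[of t] t \<mu> by (simp add: G_def)
      finally show ?thesis
        using G[of t] t by simp
    qed
    \<comment> \<open>The mean value theorem applied to G(s) / s, whose derivative is 0, on the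
      interval from \<open>t\<close> to 1.\<close>
    have const: "G t / t = G 1" if t: "0 < t" "t < 1" for t
    proof -
      have "\<exists>z>t. z < 1 \<and> G 1 / 1 - G t / t = (1 - t) * 0"
      proof (rule MVT2[OF t(2)])
        fix s assume "t \<le> s" "s \<le> 1"
        then have "0 < s" "(G has_real_derivative G s / s) (at s)"
          using t by (auto intro: G')
        then show "((\<lambda>s. G s / s) has_real_derivative 0) (at s)"
          using DERIV_divide[OF _ DERIV_ident, of G "G s / s" s UNIV] by simp
      qed
      then show ?thesis by auto
    qed
    have "G 0 = 0"
      by (simp add: G_def c0 g(2))
    \<comment> \<open>At the origin g' is 1 and each \<open>h' i 0\<close> cancels the partial
      derivative of \<open>f\<close>.\<close>
    have "(G has_real_derivative (\<Sum>i\<in>UNIV. y i)) (at 0)"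
      using G[of 0] p by (simp add: c0 g(3) h'_0)
    then have "((\<lambda>t. G t / t) \<longlongrightarrow> (\<Sum>i\<in>UNIV. y i)) (at 0)"
      using \<open>G 0 = 0\<close> by (simp add: DERIV_def)
    then have "((\<lambda>t. G t / t) \<longlongrightarrow> (\<Sum>i\<in>UNIV. y i)) (at_right 0)"
      by (rule tendsto_within_subset) simp
    moreover have "\<forall>\<^sub>F t in at_right 0. G t / t = G 1"
      using eventually_at_right_real[of 0 1, OF zero_less_one] by eventually_elim (use const in auto)
    then have "((\<lambda>t. G t / t) \<longlongrightarrow> G 1) (at_right 0)"
      by (rule tendsto_eventually)
    ultimately have "G 1 = (\<Sum>i\<in>UNIV. y i)"
      by (intro tendsto_unique[of "at_right (0::real)"]) auto
    then show ?thesis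
      by (simp add: G_def c1 y_def)
  qed
  have "\<forall>\<^sub>F x in nhds 0. x \<in> {x :: real^'n. \<forall>i. x $ i \<in> ?J}"
    using \<delta>(1) by (intro eventually_nhds_in_open open_cube) simp
  then show ?thesis
    by eventually_elim (use main in \<open>simp add: h_def\<close>)
qed

theorem proposition2p1:
  fixes U :: "(real^'n) set"
    and f :: "real^'n \<Rightarrow> real"
    and X :: "real^'n \<Rightarrow> real^'n"
  assumes "open U" and "0 \<in> U"
    and "web_on U (coordinate_web f)"
    and "infinitesimal_isomorphism_on U f X"
    and "X 0 = 0"
    and "\<not> (\<forall>\<^sub>F x in nhds 0. X x = 0)"
  shows "parallelizable U (coordinate_web f)"
proof -
  have f: "real_analytic_on U f"
  proof -
    have "submersion_on U (coordinate_web f None)"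
      using assms(3) unfolding web_on_def by blast
    then show ?thesis
      by (simp add: submersion_on_def coordinate_web_def)
  qed
  have partial: "gradient f x $ i \<noteq> 0" if "x \<in> U" for x i
    by (rule coordinate_web_partial_nonzero[OF assms(3) that])
  have diff: "f differentiable at x" if "x \<in> U" for x
    using f that by (intro real_analytic_at_imp_differentiable) (simp add: real_analytic_on_def)
  have cont: "isCont f 0"
    using differentiable_imp_continuous_within[OF diff[OF assms(2)]] .
  have axis_an: "real_analytic_at (\<lambda>s. f (axis i s)) 0" for i
    using f assms(2) by (intro real_analytic_at_axis) (simp add: real_analytic_on_def)
  obtain \<xi> :: "'n \<Rightarrow> real \<Rightarrow> real" where X: "\<And>x. x \<in> U \<Longrightarrow> X x = (\<chi> i. \<xi> i (x $ i))"
    using assms(4) unfolding infinitesimal_isomorphism_on_def by blast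
  obtain \<phi> :: "real \<Rightarrow> real" where \<phi>: "real_analytic_on (f ` U) \<phi>"
    and X\<phi>: "\<And>x. x \<in> U \<Longrightarrow> X x \<bullet> gradient f x = \<phi> (f x)"
    using assms(4) unfolding infinitesimal_isomorphism_on_def by blast
  have E: "(\<Sum>i\<in>UNIV. \<xi> i (x $ i) * gradient f x $ i) = \<phi> (f x)" if "x \<in> U" for x
    using X\<phi>[OF that] X[OF that] by (simp add: inner_vec_def)
  have \<xi>0: "\<xi> i 0 = 0" for i
    using X[OF assms(2)] assms(5) by (simp add: vec_eq_iff)
  \<comment> \<open>On the i-th axis the other coordinates are 0, where the other components of X
    vanish, so one summand of \<open>E\<close> survives.\<close>
  have \<xi>: "\<xi> i s * gradient f (axis i s) $ i = \<phi> (f (axis i s))" if "axis i s \<in> U" for i s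
  proof -
    have "(\<Sum>j\<in>UNIV. \<xi> j (axis i s $ j) * gradient f (axis i s) $ j)
        = (\<Sum>j\<in>UNIV. if j = i then \<xi> i s * gradient f (axis i s) $ i else 0)"
      by (intro sum.cong) (auto simp: axis_def \<xi>0)
    then show ?thesis
      using E[OF that] by simp
  qed
  \<comment> \<open>The dimension matters only for finding \<open>g\<close>; the coordinates are
    built from it in the same way in both cases.\<close>
  have "\<exists>g d. real_analytic_at g (f 0) \<and> (g has_real_derivative d) (at (f 0)) \<and> d \<noteq> 0 \<and>
      (\<forall>\<^sub>F x in nhds 0. g (f x) = (\<Sum>i\<in>UNIV. g (f (axis i (x $ i)))))"
  proof (cases "CARD('n) = 1")
    \<comment> \<open>In dimension 1 the relation n = n^k says nothing about k, but the single axis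
      is the whole space and the identity serves as \<open>g\<close>.\<close>
    case True
    then obtain i :: 'n where i: "UNIV = {i}"
      by (auto simp: card_1_singleton_iff)
    have "axis i (x $ i) = x" for x :: "real^'n"
      using i by (auto simp: vec_eq_iff axis_def)
    then have "\<forall>\<^sub>F x in nhds 0. f x = (\<Sum>i\<in>UNIV. f (axis i (x $ i)))"
      by (simp add: i)
    moreover have "real_analytic_at (\<lambda>t. t) (f 0)"
      by (rule real_analytic_at_Re_holomorphic[OF zero_less_one holomorphic_on_ident]) simp
    ultimately show ?thesis
      by (intro exI[of _ "\<lambda>t. t"] exI[of _ 1]) auto
  next
    case False
    then have n: "2 \<le> CARD('n)"
      using zero_less_card_finite[where 'a = 'n] by linarith
    have \<phi>0: "\<phi> (f 0) = 0"
      using X\<phi>[OF assms(2)] assms(5) by simp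
    \<comment> \<open>Otherwise, on each axis near 0, the product of \<open>\<xi> i\<close> with a
      nonvanishing partial derivative is 0, so X vanishes near the origin.\<close>
    have nz: "\<not> (\<forall>\<^sub>F t in nhds (f 0). \<phi> t = 0)"
    proof
      assume ev: "\<forall>\<^sub>F t in nhds (f 0). \<phi> t = 0"
      have "\<forall>\<^sub>F x in nhds 0. \<xi> i (x $ i) = 0" for i
      proof -
        have "((\<lambda>x. axis i (x $ i)) \<longlongrightarrow> (axis i (0 $ i) :: real^'n)) (nhds (0 :: real^'n))"
        proof (rule vec_tendstoI)
          fix j
          show "((\<lambda>x. axis i (x $ i) $ j) \<longlongrightarrow> (axis i (0 $ i) :: real^'n) $ j) (nhds (0 :: real^'n))"
            using tendsto_vec_nth[OF filterlim_ident[of "nhds (0 :: real^'n)"], of i] by (cases "j = i") (simp_all add: axis_def)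
        qed
        then have lim: "filterlim (\<lambda>x. axis i (x $ i) :: real^'n) (nhds 0) (nhds (0 :: real^'n))"
          by (simp add: axis_zero)
        then have "((\<lambda>x. f (axis i (x $ i))) \<longlongrightarrow> f 0) (nhds (0 :: real^'n))"
          by (rule isCont_tendsto_compose[OF cont])
        from eventually_compose_filterlim[OF ev this]
          eventually_compose_filterlim[OF eventually_nhds_in_open[OF assms(1,2)] lim]
        show ?thesis
          by eventually_elim (metis \<xi> partial mult_eq_0_iff)
      qed
      then have "\<forall>\<^sub>F x in nhds 0. \<forall>i. \<xi> i (x $ i) = 0"
        by (rule eventually_all_finite)
      with eventually_nhds_in_open[OF assms(1,2)] have "\<forall>\<^sub>F x in nhds 0. X x = 0"
        by eventually_elim (simp add: X vec_eq_iff)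
      with assms(6) show False ..
    qed
    have "real_analytic_at \<phi> (f 0)"
      using \<phi> assms(2) by (simp add: real_analytic_on_def)
    from real_analytic_at_factor_zero[OF this \<phi>0 nz] obtain k \<psi>
      where \<psi>: "real_analytic_at \<psi> (f 0)" "\<psi> (f 0) \<noteq> 0"
        and k: "\<forall>\<^sub>F t in nhds (f 0). \<phi> t = (t - f 0) ^ k * \<psi> t"
      by metis
    have \<psi>_cont: "isCont \<psi> (f 0)"
      by (rule differentiable_imp_continuous_within[OF real_analytic_at_imp_differentiable[OF \<psi>(1)]])
    have "k = 1"
      by (rule vanishing_order_one[where \<xi> = \<xi> and \<phi> = \<phi>, OF assms(1,2) f partial[OF assms(2)] E \<xi> k \<psi>_cont \<psi>(2) n])
    obtain g g' where g: "real_analytic_at g (f 0)" "g (f 0) = 0" "g' (f 0) = 1"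
      and lin: "\<forall>\<^sub>F t in nhds (f 0). (g has_real_derivative g' t) (at t) \<and>
        (t - f 0) * \<psi> t * g' t = \<psi> (f 0) * g t"
      by (rule linearizing_coordinate[OF \<psi>]) (rule that)
    \<comment> \<open>With k = 1 the local form of \<open>\<phi>\<close> is exactly the field that
      \<open>g\<close> linearizes; the eigenvalue is \<open>\<psi> (f 0)\<close>.\<close>
    from lin k have lin': "\<forall>\<^sub>F t in nhds (f 0). (g has_real_derivative g' t) (at t) \<and> \<phi> t * g' t = \<psi> (f 0) * g t"
      by eventually_elim (simp add: \<open>k = 1\<close>)
    have "\<forall>\<^sub>F x in nhds 0. g (f x) = (\<Sum>i\<in>UNIV. g (f (axis i (x $ i))))"
      by (rule linearized_first_integral_separates[where \<xi> = \<xi> and \<phi> = \<phi> and g = g and g' = g',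
            OF assms(1,2) f partial[OF assms(2)] E \<xi> g lin' \<psi>(2)])
    moreover have "(g has_real_derivative 1) (at (f 0))"
      using eventually_nhds_x_imp_x[OF lin] g(3) by simp
    ultimately show ?thesis
      using g(1) by (intro exI[of _ g] exI[of _ 1] conjI zero_neq_one[symmetric])
  qed
  then obtain g d where g: "real_analytic_at g (f 0)" "(g has_real_derivative d) (at (f 0))" "d \<noteq> 0"
    and sep: "\<forall>\<^sub>F x in nhds 0. g (f x) = (\<Sum>i\<in>UNIV. g (f (axis i (x $ i))))"
    by blast
  show ?thesis
  proof (rule parallelizable_coordinate_web[OF assms(1,2) cont g _ _ _ sep])
    fix i
    show "real_analytic_at (\<lambda>s. g (f (axis i s))) 0"
      by (rule real_analytic_at_compose[OF axis_an]) (simp add: axis_zero g(1))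
    show "((\<lambda>s. g (f (axis i s))) has_real_derivative d * gradient f 0 $ i) (at 0)"
      using DERIV_chain2[of g d "\<lambda>s. f (axis i s)" 0] DERIV_along_axis[of f i 0] g(2) diff[OF assms(2)]
      by (simp add: axis_zero)
    show "d * gradient f 0 $ i \<noteq> 0"
      using g(3) partial[OF assms(2)] by simp
  qed
qed

end
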